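(* Let $d\in\mathbb{N}^*$, $\mu>0$, $\delta\in[0,1)$, $\epsilon\ge 0$, and let $\mathcal{Y}^0\subset\mathcal{Y}$ be finite. Consider the cutting-plane algorithm (described in the context) applied to $(\mathrm{SIP}_\mu)$ with these inputs. (1) If $\epsilon>0$, the algorithm stops after a finite number $K$ of iterations, and $\theta^K+\frac{\epsilon}{1-\delta}\hat\theta$ is feasible and $r_\mu\!\left(\frac{\epsilon}{1-\delta}\right)$-optimal in $(\mathrm{SIP}_\mu)$. (2) If $\epsilon=0$, then the following alternative holds: (a) either the algorithm stops after a finite number of iterations, and the last iterate is the optimal solution of $(\mathrm{SIP}_\mu)$; (b) or it generates an infinite sequence $(\theta^k)_k$, and the optimality gap and the feasibility error of $\theta^k$ converge to zero with an asymptotic rate in $O(1/k)$.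
   Context: Setting. Let $n,m\ge 1$ be integers, $T>0$, $f:\mathbb{R}\times\mathbb{R}^n\times\mathbb{R}^m\to\mathbb{R}^n$ Lipschitz continuous, $U\subset\mathbb{R}^m$ a nonempty compact set, $X\subset\mathbb{R}^n$ and $K_{\rm tar}\subset X$ compact sets ($K_{\rm tar}$ is the target set), and $x_0\in X$. Standing assumption: there are $t_1\in[0,T]$ and a measurable $u:[0,t_1]\to U$ such that the solution of $\dot x(t)=f(t,x(t),u(t))$, $x(0)=x_0$, satisfies $x(t)\in X$ for a.e. $t\in[0,t_1]$ and $x(t_1)\in K_{\rm tar}$. Let $N$ be the dimension of the space $\mathbb{R}_d[t,x_1,\dots,x_n]$ of real polynomials of degree at most $d$, and let $\Phi(t,x)\in\mathbb{R}^N$ be the vector of elements of a basis of this space, so that each $\theta\in\mathbb{R}^N$ corresponds to the polynomial $V_\theta(t,x)=\theta^\top\Phi(t,x)$. Set $c=\Phi(0,x_0)$ and $\mathcal{Y}=\mathcal{Y}_1\cup\mathcal{Y}_2\subset\mathbb{R}^{N}\times\mathbb{R}$ with $$\mathcal{Y}_1=\{(-\partial_t\Phi(t,x)-\nabla_x\Phi(t,x)^\top f(t,x,u),\,-1):(t,x,u)\in[0,T]\times X\times U\},$$ $$\mathcal{Y}_2=\{(\Phi(t,x),0):(t,x)\in[0,T]\times K_{\rm tar}\},$$ where $\nabla_x\Phi(t,x)^\top f$ is the vector whose $j$-th entry is $\nabla_x\Phi_j(t,x)^\top f$. The problem $(\mathrm{SIP}_\mu)$ is $$\max_{\theta\in\mathbb{R}^N}\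 c^\top\theta-\tfrac{\mu}{2}\|\theta\|^2\quad\text{s.t.}\quad a^\top\theta+b\le 0\ \ \forall(a,b)\in\mathcal{Y},$$ with value $\mathsf{val}(\mathrm{SIP}_\mu)$. Let $\phi(\theta)=\max_{(a,b)\in\mathcal{Y}}(a^\top\theta+b)$. A feasible $\theta$ is $e$-optimal if $c^\top\theta-\frac{\mu}{2}\|\theta\|^2\ge \mathsf{val}(\mathrm{SIP}_\mu)-e$. The feasibility error of $\theta$ is $\max\{0,\phi(\theta)\}$, and its optimality gap is $\left|c^\top\theta-\frac{\mu}{2}\|\theta\|^2-\mathsf{val}(\mathrm{SIP}_\mu)\right|$. Oracle. An oracle with relative optimality gap $\delta\in[0,1)$ returns, for each $\theta\in\mathbb{R}^N$, a pair $(a,b)\in\mathcal{Y}$ with $\phi(\theta)-(a^\top\theta+b)\le\delta|\phi(\theta)|$. Cutting-plane algorithm. Inputs: an oracle with parameter $\delta$, a tolerance $\epsilon\ge 0$, a finite set $\mathcal{Y}^0\subset\mathcal{Y}$; start with $k=0$. Iteration $k$: (i) compute $\theta^k$, the solution of the convex quadratic program $\max_{\theta\in\mathbb{R}^N}c^\top\theta-\frac{\mu}{2}\|\theta\|^2$ s.t. $a^\top\theta+b\le0$ for all $(a,b)\in\mathcal{Y}^k$; (ii) call the oracle at $\theta^k$ to get $(a^k,b^k)$; (iii) if $(a^k)^\top\theta^k+b^k\le\epsilon$, stop and return $\theta^k$; otherwise set $\mathcal{Y}^{k+1}=\mathcal{Y}^k\cup\{(a^k,b^k)\}$ and go to iteration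 $k+1$. In the claim, $\theta^K$ is the iterate returned on stopping. Further notation. $\hat\theta\in\mathbb{R}^N$ is the coordinate vector in the basis $\Phi$ of the polynomial $\hat v(t,x)=t-1-T$. $\mathcal{X}_\mu=\{\theta\in\mathbb{R}^N: c^\top\theta-\frac{\mu}{2}\|\theta\|^2\ge c^\top\hat\theta-\frac{\mu}{2}\|\hat\theta\|^2\}$, $R_\mu=\sup_{\theta\in\mathcal{X}_\mu}\|\theta\|$, and $r_\mu(e)=e\left(1+T+\mu R_\mu^2\left(1+\frac{e}{2}\right)\right)$. *)

theory Defs
  imports "HOL-Analysis.Analysis" "HOL-Library.Landau_Symbols"
begin

section \<open>Control system\<close>

text \<open>
  Caratheodory solutions of \<open>x' = f (t, x, u)\<close>, \<open>x 0 = x0\<close> on \<open>{0..t1}\<close>, in integral form.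
  The function values of \<open>x\<close> and \<open>u\<close> outside \<open>{0..t1}\<close> are irrelevant.
\<close>

definition solves_ode_control ::
  "(real \<times> (real^'n) \<times> (real^'m) \<Rightarrow> real^'n) \<Rightarrow> real^'n \<Rightarrow> real \<Rightarrow> (real \<Rightarrow> real^'m) \<Rightarrow> (real \<Rightarrow> real^'n) \<Rightarrow> bool"
where
  "solves_ode_control f x0 t1 u x \<longleftrightarrow>
     continuous_on {0..t1} x \<and>
     (\<forall>t\<in>{0..t1}.
        set_integrable lebesgue {0..t} (\<lambda>s. f (s, x s, u s)) \<and>
        x t = x0 + (LINT s:{0..t}|lebesgue. f (s, x s, u s)))"

definition target_reachable ::
  "(real \<times> (real^'n) \<times> (real^'m) \<Rightarrow> real^'n) \<Rightarrow> (real^'m) set \<Rightarrow> (real^'n) set \<Rightarrow> (real^'n) set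
     \<Rightarrow> real^'n \<Rightarrow> real \<Rightarrow> bool"
where
  "target_reachable f U X Ktar x0 T \<longleftrightarrow>
     (\<exists>t1\<in>{0..T}. \<exists>u x.
        u \<in> borel_measurable (lebesgue_on {0..t1}) \<and> u ` {0..t1} \<subseteq> U \<and>
        solves_ode_control f x0 t1 u x \<and>
        (AE t in lebesgue_on {0..t1}. x t \<in> X) \<and> x t1 \<in> Ktar)"


section \<open>Polynomials of bounded degree\<close>

text \<open>
  Real polynomials in \<open>t, x\<^sub>1, \<dots>, x\<^sub>n\<close> are identified with the functions they induce on
  \<open>real \<times> real^'n\<close>, which is harmless because the field is infinite. The degree is the total degree;
  a pair \<open>(i, \<alpha>)\<close> is the exponent of the monomial \<open>t\<^sup>i x\<^sup>\<alpha>\<close>.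
\<close>

definition exponents_upto :: "nat \<Rightarrow> (nat \<times> ('n::finite \<Rightarrow> nat)) set" where
  "exponents_upto d = {(i, \<alpha>). i + (\<Sum>j\<in>UNIV. \<alpha> j) \<le> d}"

lemma finite_exponents_upto: "finite (exponents_upto d :: (nat \<times> ('n::finite \<Rightarrow> nat)) set)"
proof (rule finite_subset)
  show "exponents_upto d \<subseteq> {..d} \<times> PiE (UNIV :: 'n set) (\<lambda>_. {..d})"
  proof
    fix z :: "nat \<times> ('n \<Rightarrow> nat)" assume z: "z \<in> exponents_upto d"
    obtain i \<alpha> where [simp]: "z = (i, \<alpha>)" by (cases z)
    have le: "i + (\<Sum>j\<in>UNIV. \<alpha> j) \<le> d"
      using z by (simp add: exponents_upto_def)
    have "\<alpha> j \<le> (\<Sum>j\<in>UNIV. \<alpha> j)" for j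
      by (rule member_le_sum) auto
    with le have "\<alpha> j \<le> d" for j
      by (meson add_leD2 le_trans)
    with le show "z \<in> {..d} \<times> PiE UNIV (\<lambda>_. {..d})"
      by auto
  qed
  show "finite ({..d} \<times> PiE (UNIV :: 'n set) (\<lambda>_. {..d}))"
    by (intro finite_cartesian_product finite_PiE) auto
qed

definition polys_upto :: "nat \<Rightarrow> (real \<times> (real^'n) \<Rightarrow> real) set" where
  "polys_upto d =
     {p. \<exists>C. \<forall>t x. p (t, x) = (\<Sum>(i, \<alpha>)\<in>exponents_upto d. C (i, \<alpha>) * (t ^ i * (\<Prod>j\<in>UNIV. x $ j ^ \<alpha> j)))}"

text \<open>
  The components of \<open>\<Phi>\<close> lie in the space, span it and are linearly independent; in particular
  \<open>CARD('k)\<close> is the dimension of \<open>polys_upto d\<close>.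
\<close>

definition is_poly_basis :: "nat \<Rightarrow> (real \<times> (real^'n) \<Rightarrow> real^'k) \<Rightarrow> bool" where
  "is_poly_basis d \<Phi> \<longleftrightarrow>
     (\<forall>j. (\<lambda>z. \<Phi> z $ j) \<in> polys_upto d) \<and>
     (\<forall>p\<in>polys_upto d. \<exists>\<theta>. \<forall>z. p z = (\<Sum>j\<in>UNIV. \<theta> $ j * \<Phi> z $ j)) \<and>
     (\<forall>\<theta>. (\<forall>z. (\<Sum>j\<in>UNIV. \<theta> $ j * \<Phi> z $ j) = 0) \<longrightarrow> \<theta> = 0)"

definition coords :: "(real \<times> (real^'n) \<Rightarrow> real^'k) \<Rightarrow> (real \<times> (real^'n) \<Rightarrow> real) \<Rightarrow> real^'k" where
  "coords \<Phi> p = (THE \<theta>. \<forall>z. p z = \<theta> \<bullet> \<Phi> z)"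


section \<open>The constraint set of the semi-infinite program\<close>

definition gradient :: "(real^'n \<Rightarrow> real) \<Rightarrow> real^'n \<Rightarrow> real^'n" where
  "gradient g x = (THE D. GDERIV g x :> D)"

definition sip_Y1 ::
  "(real \<times> (real^'n) \<times> (real^'m) \<Rightarrow> real^'n) \<Rightarrow> real \<Rightarrow> (real^'n) set \<Rightarrow> (real^'m) set
     \<Rightarrow> (real \<times> (real^'n) \<Rightarrow> real^'k) \<Rightarrow> ((real^'k) \<times> real) set"
where
  "sip_Y1 f T X U \<Phi> =
     {(\<chi> j. - deriv (\<lambda>s. \<Phi> (s, x) $ j) t - gradient (\<lambda>y. \<Phi> (t, y) $ j) x \<bullet> f (t, x, u), -1) | t x u.
        t \<in> {0..T} \<and> x \<in> X \<and> u \<in> U}"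

definition sip_Y2 ::
  "real \<Rightarrow> (real^'n) set \<Rightarrow> (real \<times> (real^'n) \<Rightarrow> real^'k) \<Rightarrow> ((real^'k) \<times> real) set"
where
  "sip_Y2 T Ktar \<Phi> = {(\<Phi> (t, x), 0) | t x. t \<in> {0..T} \<and> x \<in> Ktar}"

definition sip_Y ::
  "(real \<times> (real^'n) \<times> (real^'m) \<Rightarrow> real^'n) \<Rightarrow> real \<Rightarrow> (real^'n) set \<Rightarrow> (real^'m) set \<Rightarrow> (real^'n) set
     \<Rightarrow> (real \<times> (real^'n) \<Rightarrow> real^'k) \<Rightarrow> ((real^'k) \<times> real) set"
where
  "sip_Y f T X U Ktar \<Phi> = sip_Y1 f T X U \<Phi> \<union> sip_Y2 T Ktar \<Phi>"


section \<open>Quadratic (semi-infinite) programs\<close>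

text \<open>
  \<open>A\<close> is any set of cuts \<open>(a, b)\<close>: the whole index set of the semi-infinite program, or
  the finite set of cuts of one iteration of the algorithm.
\<close>

definition objective :: "real^'k \<Rightarrow> real \<Rightarrow> real^'k \<Rightarrow> real" where
  "objective c \<mu> \<theta> = c \<bullet> \<theta> - \<mu> / 2 * (norm \<theta>)\<^sup>2"

definition feasible :: "((real^'k) \<times> real) set \<Rightarrow> real^'k \<Rightarrow> bool" where
  "feasible A \<theta> \<longleftrightarrow> (\<forall>(a, b)\<in>A. a \<bullet> \<theta> + b \<le> 0)"

definition solutions :: "real^'k \<Rightarrow> real \<Rightarrow> ((real^'k) \<times> real) set \<Rightarrow> (real^'k) set" where
  "solutions c \<mu> A = {\<theta>. is_arg_max (objective c \<mu>) (feasible A) \<theta>}"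

definition val :: "real^'k \<Rightarrow> real \<Rightarrow> ((real^'k) \<times> real) set \<Rightarrow> real" where
  "val c \<mu> A = (SUP \<theta>\<in>{\<theta>. feasible A \<theta>}. objective c \<mu> \<theta>)"

text \<open>For compact nonempty \<open>A\<close> the supremum is attained, so it is the maximum.\<close>

definition max_violation :: "((real^'k) \<times> real) set \<Rightarrow> real^'k \<Rightarrow> real" where
  "max_violation A \<theta> = (SUP (a, b)\<in>A. a \<bullet> \<theta> + b)"

definition e_optimal :: "real^'k \<Rightarrow> real \<Rightarrow> ((real^'k) \<times> real) set \<Rightarrow> real \<Rightarrow> real^'k \<Rightarrow> bool" where
  "e_optimal c \<mu> A e \<theta> \<longleftrightarrow> feasible A \<theta> \<and> objective c \<mu> \<theta> \<ge> val c \<mu> A - e"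

definition feasibility_error :: "((real^'k) \<times> real) set \<Rightarrow> real^'k \<Rightarrow> real" where
  "feasibility_error A \<theta> = max 0 (max_violation A \<theta>)"

definition optimality_gap :: "real^'k \<Rightarrow> real \<Rightarrow> ((real^'k) \<times> real) set \<Rightarrow> real^'k \<Rightarrow> real" where
  "optimality_gap c \<mu> A \<theta> = \<bar>objective c \<mu> \<theta> - val c \<mu> A\<bar>"


section \<open>The cutting-plane algorithm\<close>

definition is_oracle ::
  "((real^'k) \<times> real) set \<Rightarrow> real \<Rightarrow> (real^'k \<Rightarrow> (real^'k) \<times> real) \<Rightarrow> bool"
where
  "is_oracle A \<delta> orc \<longleftrightarrow>
     (\<forall>\<theta>. orc \<theta> \<in> A \<and>
          (case orc \<theta> of (a, b) \<Rightarrow>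
             max_violation A \<theta> - (a \<bullet> \<theta> + b) \<le> \<delta> * \<bar>max_violation A \<theta>\<bar>))"

definition qp_solution :: "real^'k \<Rightarrow> real \<Rightarrow> ((real^'k) \<times> real) set \<Rightarrow> real^'k" where
  "qp_solution c \<mu> A = (THE \<theta>. \<theta> \<in> solutions c \<mu> A)"

text \<open>
  The recursion ignores the stopping test and is therefore total; the actual run of the algorithm
  is its initial segment up to the first index at which the test succeeds, if there is one.
\<close>

primrec cp_cuts ::
  "real^'k \<Rightarrow> real \<Rightarrow> (real^'k \<Rightarrow> (real^'k) \<times> real) \<Rightarrow> ((real^'k) \<times> real) set \<Rightarrow> nat \<Rightarrow> ((real^'k) \<times> real) set"
where
  "cp_cuts c \<mu> orc Y0 0 = Y0"
| "cp_cuts c \<mu> orc Y0 (Suc k) =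
     cp_cuts c \<mu> orc Y0 k \<union> {orc (qp_solution c \<mu> (cp_cuts c \<mu> orc Y0 k))}"

definition cp_iterate ::
  "real^'k \<Rightarrow> real \<Rightarrow> (real^'k \<Rightarrow> (real^'k) \<times> real) \<Rightarrow> ((real^'k) \<times> real) set \<Rightarrow> nat \<Rightarrow> real^'k"
where
  "cp_iterate c \<mu> orc Y0 k = qp_solution c \<mu> (cp_cuts c \<mu> orc Y0 k)"

definition cp_test ::
  "real^'k \<Rightarrow> real \<Rightarrow> (real^'k \<Rightarrow> (real^'k) \<times> real) \<Rightarrow> real \<Rightarrow> ((real^'k) \<times> real) set \<Rightarrow> nat \<Rightarrow> bool"
where
  "cp_test c \<mu> orc \<epsilon> Y0 k \<longleftrightarrow>
     (let \<theta> = cp_iterate c \<mu> orc Y0 k; (a, b) = orc \<theta> in a \<bullet> \<theta> + b \<le> \<epsilon>)"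

definition cp_stops_at ::
  "real^'k \<Rightarrow> real \<Rightarrow> (real^'k \<Rightarrow> (real^'k) \<times> real) \<Rightarrow> real \<Rightarrow> ((real^'k) \<times> real) set \<Rightarrow> nat \<Rightarrow> bool"
where
  "cp_stops_at c \<mu> orc \<epsilon> Y0 K \<longleftrightarrow>
     cp_test c \<mu> orc \<epsilon> Y0 K \<and> (\<forall>k<K. \<not> cp_test c \<mu> orc \<epsilon> Y0 k)"

definition cp_runs_forever ::
  "real^'k \<Rightarrow> real \<Rightarrow> (real^'k \<Rightarrow> (real^'k) \<times> real) \<Rightarrow> real \<Rightarrow> ((real^'k) \<times> real) set \<Rightarrow> bool"
where
  "cp_runs_forever c \<mu> orc \<epsilon> Y0 \<longleftrightarrow> (\<forall>k. \<not> cp_test c \<mu> orc \<epsilon> Y0 k)"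


section \<open>The constants of the error bound\<close>

definition level_set :: "real^'k \<Rightarrow> real \<Rightarrow> real^'k \<Rightarrow> (real^'k) set" where
  "level_set c \<mu> \<theta>h = {\<theta>. objective c \<mu> \<theta> \<ge> objective c \<mu> \<theta>h}"

definition level_radius :: "real^'k \<Rightarrow> real \<Rightarrow> real^'k \<Rightarrow> real" where
  "level_radius c \<mu> \<theta>h = (SUP \<theta>\<in>level_set c \<mu> \<theta>h. norm \<theta>)"

definition opt_bound :: "real^'k \<Rightarrow> real \<Rightarrow> real^'k \<Rightarrow> real \<Rightarrow> real \<Rightarrow> real" where
  "opt_bound c \<mu> \<theta>h T e = e * (1 + T + \<mu> * (level_radius c \<mu> \<theta>h)\<^sup>2 * (1 + e / 2))"

end

theory Submission
  imports Defs
begin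

text \<open>
  The delicate claim is the rate of the feasibility error along the \<^emph>\<open>whole\<close> sequence of iterates.
  A step with violation \<open>v\<close> lowers the objective by at least a multiple of \<open>v\<^sup>2\<close>, and by the Slater point
  \<open>\<theta>h\<close> the optimality gap is at most a multiple of \<open>v\<close>. This alone only gives the gap the rate
  \<open>1 / k\<close>, hence the violation of the last iterate the rate \<open>1 / sqrt k\<close>. In fixed dimension the gap
  actually decays like \<open>1 / k\<^sup>2\<close>, which yields \<open>1 / k\<close> for the violation.

  To see this, write the optimality of \<open>\<theta>\<^sub>k\<close> with at most \<open>m = N + 1\<close> multipliers on the cuts (Caratheodory). Given
  \<open>s < k\<close>, let the pivot be the cut with the largest multiplier among those generated at a step \<open>\<ge> s\<close>.
  Starting from \<open>s = 0\<close> and restarting right after the pivot, \<open>k\<close> is reached in at most \<open>m\<close> moves.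
  Because the cuts returned by the separation step are almost most violated, a pivot cut takes values of the order of its
  own violation at all iterates that are relevant, on both sides; hence, for pivots of comparable
  violation and comparable multiplier, a volume argument bounds their number by a constant. With logarithmically many
  dyadic classes, the number of iterations with gap \<open>\<ge> \<eta>\<close> is polylogarithmic in \<open>1 / \<eta>\<close>.
\<close>

section \<open>Counting pivots of a sequence of cuts\<close>

text \<open>Volume comparison: translates of one symmetric convex body \<open>B\<close> to the
  points \<open>x i\<close> are disjoint, because some functional separates any two points by at
  least 1, and all of them lie in one dilation of \<open>B\<close>. The bound does not involve the
  number of functionals, which grows with \<open>J\<close>.\<close>

lemma card_le_of_separating_functionals:
  fixes x a :: "'i \<Rightarrow> 'a::euclidean_space"
  assumes "finite J" and "0 \<le> R"
    and bound: "\<And>p i j. p \<in> J \<Longrightarrow> i \<in> J \<Longrightarrow> j \<in> J \<Longrightarrow> \<bar>a p \<bullet> (x i - x j)\<bar> \<le> R"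
    and sep: "\<And>i j. i \<in> J \<Longrightarrow> j \<in> J \<Longrightarrow> i \<noteq> j \<Longrightarrow> \<exists>p\<in>J. 1 \<le> \<bar>a p \<bullet> (x i - x j)\<bar>"
  shows "real (card J) \<le> (2 * R + 2) ^ DIM('a)"
proof (cases "J = {}")
  case False
  then obtain j0 where j0: "j0 \<in> J" by blast
  \<comment> \<open>The functionals alone would allow the factor \<open>2 * R + 1\<close>; the ball
    inside \<open>B\<close> requires a factor of at least 2, since norms up to \<open>r + r\<close>
    occur. This value serves both.\<close>
  define t where "t = 2 * R + 2"
  have t: "t \<ge> 2" using \<open>0 \<le> R\<close> by (simp add: t_def)
  obtain r where r: "r > 0" "\<And>i. i \<in> J \<Longrightarrow> norm (x i - x j0) \<le> r"
  proof
    show "0 < 1 + (\<Sum>i\<in>J. norm (x i - x j0))"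
      by (simp add: add_pos_nonneg sum_nonneg)
    show "norm (x i - x j0) \<le> 1 + (\<Sum>i\<in>J. norm (x i - x j0))" if "i \<in> J" for i
      using member_le_sum[of i J "\<lambda>i. norm (x i - x j0)"] that \<open>finite J\<close> by simp
  qed
  \<comment> \<open>The functionals need not span the space, so the slabs alone may have unbounded
    intersection; the ball makes the volume finite.\<close>
  define B where "B = (\<Inter>p\<in>J. {y. \<bar>a p \<bullet> y\<bar> < 1/2}) \<inter> ball 0 r"
  have "open {y. \<bar>a p \<bullet> y\<bar> < 1/2}" for p
    by (intro open_Collect_less continuous_intros)
  then have "open B"
    unfolding B_def using \<open>finite J\<close> by auto
  have "bounded B"
    unfolding B_def by (simp add: bounded_Int)
  have "0 \<in> B"
    unfolding B_def using r by simp
  then have "B \<noteq> {}" by blast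
  have lm: "B \<in> lmeasurable"
    using \<open>open B\<close> \<open>bounded B\<close> by (simp add: lmeasurable_open)
  have "measure lebesgue B > 0"
    using open_not_negligible[OF \<open>open B\<close> \<open>B \<noteq> {}\<close>] lm negligible_iff_measure0
    by (metis less_eq_real_def measure_nonneg)
  have disj: "disjoint_family_on (\<lambda>i. (+) (x i) ` B) J"
  proof (clarsimp simp: disjoint_family_on_def disjoint_iff image_iff)
    fix i j y z assume ij: "i \<in> J" "j \<in> J" "i \<noteq> j" and "y \<in> B" "z \<in> B" "x i + y = x j + z"
    obtain p where p: "p \<in> J" "1 \<le> \<bar>a p \<bullet> (x i - x j)\<bar>" using sep ij by blast
    have "x i - x j = z - y" using \<open>x i + y = x j + z\<close> by (simp add: algebra_simps)
    moreover have "\<bar>a p \<bullet> y\<bar> < 1/2" "\<bar>a p \<bullet> z\<bar> < 1/2" using \<open>y \<in> B\<close> \<open>z \<in> B\<close> p(1) by (auto simp: B_def)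
    ultimately show False using p(2) by (simp add: inner_diff_right abs_if split: if_splits)
  qed
  have sub: "(\<Union>i\<in>J. (+) (x i) ` B) \<subseteq> (\<lambda>y. t *\<^sub>R y + x j0) ` B"
  proof clarsimp
    fix i y assume i: "i \<in> J" and y: "y \<in> B"
    define w where "w = (1 / t) *\<^sub>R (x i - x j0 + y)"
    have "\<bar>a p \<bullet> w\<bar> < 1/2" if p: "p \<in> J" for p
    proof -
      have "\<bar>a p \<bullet> y\<bar> < 1/2" using y p by (auto simp: B_def)
      then have "\<bar>a p \<bullet> (x i - x j0 + y)\<bar> < t / 2"
        using bound[OF p i j0] abs_triangle_ineq[of "a p \<bullet> (x i - x j0)" "a p \<bullet> y"]
        unfolding inner_add_right t_def by argo
      moreover have "\<bar>a p \<bullet> w\<bar> = \<bar>a p \<bullet> (x i - x j0 + y)\<bar> / t"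
        using t by (simp add: w_def)
      ultimately show ?thesis using t by (simp add: pos_divide_less_eq)
    qed
    moreover have "norm w < r"
    proof -
      have "norm (x i - x j0 + y) \<le> norm (x i - x j0) + norm y"
        by (rule norm_triangle_ineq)
      also have "\<dots> < r + r"
        using r(2)[OF i] y by (simp add: B_def)
      also have "r + r \<le> t * r" using t r by (simp add: algebra_simps)
      finally have "norm (x i - x j0 + y) / t < r" using t by (simp add: pos_divide_less_eq mult.commute)
      then show ?thesis using t by (simp add: w_def)
    qed
    ultimately have "w \<in> B" by (auto simp: B_def)
    moreover have "x i + y = t *\<^sub>R w + x j0" using t by (simp add: w_def)
    ultimately show "x i + y \<in> (\<lambda>y. t *\<^sub>R y + x j0) ` B" by blast
  qed
  have tr: "(+) v ` B \<in> lmeasurable" "measure lebesgue ((+) v ` B) = measure lebesgue B" for v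
    using lm by (simp_all add: measurable_translation measure_translation)
  have big: "(\<lambda>y. t *\<^sub>R y + x j0) ` B \<in> lmeasurable"
    "measure lebesgue ((\<lambda>y. t *\<^sub>R y + x j0) ` B) = t ^ DIM('a) * measure lebesgue B"
  proof -
    show m: "measure lebesgue ((\<lambda>y. t *\<^sub>R y + x j0) ` B) = t ^ DIM('a) * measure lebesgue B"
      using measure_lebesgue_affine[of t "x j0" B] t by (simp add: add.commute)
    have "open ((\<lambda>y. t *\<^sub>R y) ` B)" using \<open>open B\<close> t by (simp add: open_scaling)
    then have "open ((+) (x j0) ` ((\<lambda>y. t *\<^sub>R y) ` B))" by (rule open_translation)
    moreover have "bounded ((+) (x j0) ` ((\<lambda>y. t *\<^sub>R y) ` B))"
      using \<open>bounded B\<close> by (intro bounded_translation bounded_scaling)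
    ultimately show "(\<lambda>y. t *\<^sub>R y + x j0) ` B \<in> lmeasurable"
      by (simp add: lmeasurable_open image_image add.commute)
  qed
  have "real (card J) * measure lebesgue B = (\<Sum>i\<in>J. measure lebesgue ((+) (x i) ` B))"
    by (simp add: tr)
  also have "\<dots> = measure lebesgue (\<Union>i\<in>J. (+) (x i) ` B)"
    using fmeasurableD[OF tr(1)] fmeasurableD2[OF tr(1)] \<open>finite J\<close> disj
    by (intro measure_finite_Union[symmetric]) auto
  also have "\<dots> \<le> measure lebesgue ((\<lambda>y. t *\<^sub>R y + x j0) ` B)"
    using big(1) sub \<open>finite J\<close> tr by (intro measure_mono_fmeasurable) (auto intro!: sets.finite_UN fmeasurableD)
  finally show ?thesis
    using big(2) \<open>measure lebesgue B > 0\<close> by (simp add: t_def)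
qed (use \<open>0 \<le> R\<close> in simp)

text \<open>
  The point \<open>x j\<close> generates the cut \<open>a j \<bullet> y + b j \<le> 0\<close>; \<open>\<phi> j\<close> is the maximal violation at \<open>x j\<close>, which bounds the
  value of \<^emph>\<open>every\<close> cut there, past or future. \<open>S k\<close> and \<open>l k\<close> are the support and values of the multipliers
  certifying the optimality of \<open>x k\<close>; further cuts satisfied by all points (those of \<open>Y0\<close>) need not be recorded.
\<close>

locale cut_sequence =
  fixes x a :: "nat \<Rightarrow> 'a::euclidean_space" and b g \<phi> :: "nat \<Rightarrow> real"
    and S :: "nat \<Rightarrow> nat set" and l :: "nat \<Rightarrow> nat \<Rightarrow> real" and m :: nat and c :: real
  assumes m_ge_1: "1 \<le> m" and c_pos: "0 < c"
    and g_strict: "i < k \<Longrightarrow> g k < g i"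
    and \<phi>_pos: "0 < \<phi> i"
    and cut_upper: "a j \<bullet> x i + b j \<le> \<phi> i"
    and cut_own: "c * \<phi> j \<le> a j \<bullet> x j + b j"
    and cut_later: "j < i \<Longrightarrow> a j \<bullet> x i + b j \<le> 0"
    and S_subset: "S k \<subseteq> {..<k}" and S_card: "card (S k) \<le> m"
    and l_nonneg: "0 \<le> l k j"
    and dual: "g i \<le> g k + (\<Sum>j\<in>S k. l k j * (a j \<bullet> x i + b j))"
begin

definition tail :: "nat \<Rightarrow> nat \<Rightarrow> nat set" where
  "tail k s = S k \<inter> {s..<k}"

definition pivot :: "nat \<Rightarrow> nat \<Rightarrow> nat" where
  "pivot k s = (SOME j. j \<in> tail k s \<and> (\<forall>i\<in>tail k s. l k i \<le> l k j))"

text \<open>Up to the factor \<open>m\<close>, a lower bound for the multiplier of the pivot (\<open>rate_le_pivot\<close>).\<close>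

definition rate :: "nat \<Rightarrow> nat \<Rightarrow> real" where
  "rate k s = Max ((\<lambda>i. (g i - g k) / \<phi> i) ` {s..<k})"

lemma finite_S: "finite (S k)"
  using S_subset finite_subset by blast

lemma finite_tail: "finite (tail k s)"
  by (simp add: tail_def)

lemma card_tail: "card (tail k s) \<le> m"
  using card_mono[OF finite_S, of "tail k s" k] S_card[of k] by (simp add: tail_def)

text \<open>A cut generated before step \<open>i\<close> is satisfied by \<open>x i\<close> and
  contributes nothing positive; a cut of \<open>tail k i\<close> contributes at most its multiplier
  times \<open>\<phi> i\<close>.\<close>

lemma sum_S_le_tail:
  assumes "A \<subseteq> S k"
  shows "(\<Sum>j\<in>A. l k j * (a j \<bullet> x i + b j)) \<le> (\<Sum>j\<in>A \<inter> tail k i. l k j) * \<phi> i"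
proof -
  have fin: "finite A" using assms finite_S finite_subset by blast
  have "(\<Sum>j\<in>A. l k j * (a j \<bullet> x i + b j)) \<le> (\<Sum>j\<in>A. if j \<in> tail k i then l k j * \<phi> i else 0)"
  proof (rule sum_mono)
    fix j assume "j \<in> A"
    show "l k j * (a j \<bullet> x i + b j) \<le> (if j \<in> tail k i then l k j * \<phi> i else 0)"
    proof (cases "j \<in> tail k i")
      case True
      then show ?thesis by (simp add: mult_left_mono cut_upper l_nonneg)
    next
      case False
      then have "j < i" using \<open>j \<in> A\<close> assms S_subset[of k] by (force simp: tail_def)
      then show ?thesis using cut_later[of j i] l_nonneg[of k j] False by (simp add: mult_nonneg_nonpos)
    qed
  qed
  also have "\<dots> = (\<Sum>j\<in>A \<inter> tail k i. l k j * \<phi> i)"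
    using fin by (simp add: sum.inter_restrict)
  finally show ?thesis by (simp add: sum_distrib_right)
qed

text \<open>The drop of \<open>g\<close> from \<open>i\<close> to \<open>k\<close> must be paid for
  by multipliers on cuts generated from step \<open>i\<close> on. This is what forces a large
  multiplier to exist.\<close>

lemma tail_weight: "g i - g k \<le> (\<Sum>j\<in>tail k i. l k j) * \<phi> i"
proof -
  have "S k \<inter> tail k i = tail k i" by (auto simp: tail_def)
  then show ?thesis using dual[of i k] sum_S_le_tail[of "S k" k i] by simp
qed

lemma pivot:
  assumes "s < k"
  shows pivot_in_tail: "pivot k s \<in> tail k s"
    and pivot_max: "i \<in> tail k s \<Longrightarrow> l k i \<le> l k (pivot k s)"
proof -
  \<comment> \<open>With an empty tail, \<open>tail_weight\<close> would give
    \<open>g s \<le> g k\<close>, against the strict decrease.\<close>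
  have ne: "tail k s \<noteq> {}"
    using tail_weight[of s k] g_strict[OF assms] by auto
  have "Max (l k ` tail k s) \<in> l k ` tail k s"
    using ne finite_tail by (intro Max_in) auto
  then obtain j where "j \<in> tail k s" "l k j = Max (l k ` tail k s)" by auto
  then have "\<exists>j. j \<in> tail k s \<and> (\<forall>i\<in>tail k s. l k i \<le> l k j)"
    using finite_tail by (metis Max_ge finite_imageI imageI)
  from someI_ex[OF this]
  show "pivot k s \<in> tail k s" "i \<in> tail k s \<Longrightarrow> l k i \<le> l k (pivot k s)"
    unfolding pivot_def[symmetric] by auto
qed

lemma pivot_bounds: "s < k \<Longrightarrow> s \<le> pivot k s" "s < k \<Longrightarrow> pivot k s < k" "s < k \<Longrightarrow> pivot k s \<in> S k"
  using pivot_in_tail[of s k] by (auto simp: tail_def)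

lemma sum_tail_le_pivot:
  assumes "s \<le> i" and "s < k" and "A \<subseteq> tail k i"
  shows "(\<Sum>j\<in>A. l k j) \<le> m * l k (pivot k s)"
proof -
  have "tail k i \<subseteq> tail k s" using \<open>s \<le> i\<close> by (auto simp: tail_def)
  then have "(\<Sum>j\<in>A. l k j) \<le> card A * l k (pivot k s)"
    using assms pivot_max[of s k] by (intro sum_bounded_above) blast
  also have "card A \<le> m"
    using card_mono[OF finite_tail \<open>A \<subseteq> tail k i\<close>] card_tail[of k i] by linarith
  then have "card A * l k (pivot k s) \<le> m * l k (pivot k s)"
    by (intro mult_right_mono l_nonneg) simp
  finally show ?thesis .
qed

lemma drop_le_rate: "s \<le> i \<Longrightarrow> i < k \<Longrightarrow> g i - g k \<le> rate k s * \<phi> i"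
proof -
  assume "s \<le> i" "i < k"
  then have "(g i - g k) / \<phi> i \<le> rate k s"
    unfolding rate_def by (intro Max_ge) auto
  then show ?thesis using \<phi>_pos[of i] by (simp add: field_simps)
qed

lemma rate_attained:
  assumes "s < k"
  obtains i where "s \<le> i" "i < k" "rate k s = (g i - g k) / \<phi> i"
proof -
  have "rate k s \<in> (\<lambda>i. (g i - g k) / \<phi> i) ` {s..<k}"
    unfolding rate_def using assms by (intro Max_in) auto
  then show ?thesis using that by auto
qed

lemma rate_pos: "s < k \<Longrightarrow> 0 < rate k s"
  using rate_attained[of s k] g_strict \<phi>_pos by (metis diff_gt_0_iff_gt divide_pos_pos)

text \<open>At the index attaining the maximum in \<open>rate\<close>, \<open>tail_weight\<close>
  bounds the total weight of the tail from below; at most \<open>m\<close> multipliers share it,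
  none above that of the pivot.\<close>

lemma rate_le_pivot:
  assumes "s < k"
  shows "rate k s \<le> m * l k (pivot k s)"
proof -
  obtain i where i: "s \<le> i" "i < k" "rate k s = (g i - g k) / \<phi> i"
    using rate_attained[OF assms] .
  have "g i - g k \<le> (\<Sum>j\<in>tail k i. l k j) * \<phi> i" by (rule tail_weight)
  also have "\<dots> \<le> (m * l k (pivot k s)) * \<phi> i"
    using sum_tail_le_pivot[OF i(1) assms order_refl] \<phi>_pos[of i] by (intro mult_right_mono) auto
  finally show ?thesis using i(3) \<phi>_pos[of i] by (simp add: pos_divide_le_eq)
qed

text \<open>
  The terms of \<open>dual\<close> other than the pivot contribute at most \<open>m\<close> times the largest multiplier times \<open>\<phi> i\<close>;
  since the left-hand side does not exceed the right-hand side, the pivot term cannot be much more negative than that.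
\<close>

lemma pivot_cut_lower_before:
  assumes "s \<le> i" and "i < k"
  shows "- (m * \<phi> i) \<le> a (pivot k s) \<bullet> x i + b (pivot k s)"
proof -
  define p where "p = pivot k s"
  have "s < k" using assms by simp
  have p: "p \<in> S k" using pivot_bounds(3)[OF \<open>s < k\<close>] by (simp add: p_def)
  have lp: "0 < l k p"
    using rate_le_pivot[OF \<open>s < k\<close>] rate_pos[OF \<open>s < k\<close>] m_ge_1 l_nonneg[of k p]
    by (cases "l k p = 0") (auto simp: p_def)
  have "0 \<le> g i - g k" using g_strict[OF \<open>i < k\<close>] by simp
  also have "\<dots> \<le> (\<Sum>j\<in>S k. l k j * (a j \<bullet> x i + b j))" using dual[of i k] by simp
  also have "\<dots> = l k p * (a p \<bullet> x i + b p) + (\<Sum>j\<in>S k - {p}. l k j * (a j \<bullet> x i + b j))"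
    using p finite_S by (simp add: sum.remove)
  also have "(\<Sum>j\<in>S k - {p}. l k j * (a j \<bullet> x i + b j)) \<le> (\<Sum>j\<in>(S k - {p}) \<inter> tail k i. l k j) * \<phi> i"
    by (rule sum_S_le_tail) simp
  also have "\<dots> \<le> (m * l k p) * \<phi> i"
    using sum_tail_le_pivot[OF \<open>s \<le> i\<close> \<open>s < k\<close>, of "(S k - {p}) \<inter> tail k i"] \<phi>_pos[of i]
    by (intro mult_right_mono) (auto simp: p_def)
  finally have "0 \<le> l k p * (a p \<bullet> x i + b p + m * \<phi> i)"
    by (simp add: algebra_simps)
  then have "0 \<le> a p \<bullet> x i + b p + m * \<phi> i"
    using lp by (simp add: zero_le_mult_iff)
  then show ?thesis by (simp add: p_def)
qed

text \<open>From step \<open>k\<close> on every cut of \<open>S k\<close> is satisfied, so all terms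
  of \<open>dual\<close> are nonpositive and the pivot term alone is controlled by the drop of
  \<open>g\<close> after \<open>k\<close>.\<close>

lemma pivot_cut_lower_after:
  assumes "s < k" and "k \<le> i"
  shows "rate k s * (- (a (pivot k s) \<bullet> x i + b (pivot k s))) \<le> m * (g k - g i)"
proof -
  define p where "p = pivot k s"
  have p: "p \<in> S k" "p < i" using pivot_bounds[OF \<open>s < k\<close>] \<open>k \<le> i\<close> by (auto simp: p_def)
  have neg: "a p \<bullet> x i + b p \<le> 0" by (rule cut_later[OF p(2)])
  have "g i - g k \<le> (\<Sum>j\<in>S k. l k j * (a j \<bullet> x i + b j))" using dual[of i k] by simp
  also have "\<dots> = l k p * (a p \<bullet> x i + b p) + (\<Sum>j\<in>S k - {p}. l k j * (a j \<bullet> x i + b j))"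
    using p finite_S by (simp add: sum.remove)
  also have "(\<Sum>j\<in>S k - {p}. l k j * (a j \<bullet> x i + b j)) \<le> 0"
    using S_subset[of k] \<open>k \<le> i\<close> l_nonneg cut_later
    by (intro sum_nonpos mult_nonneg_nonpos) (auto dest!: subsetD)
  finally have *: "l k p * (- (a p \<bullet> x i + b p)) \<le> g k - g i" by (simp add: algebra_simps)
  have "rate k s * (- (a p \<bullet> x i + b p)) \<le> (m * l k p) * (- (a p \<bullet> x i + b p))"
    using rate_le_pivot[OF \<open>s < k\<close>] neg by (intro mult_right_mono) (auto simp: p_def)
  also have "\<dots> \<le> m * (g k - g i)"
    using mult_left_mono[OF *, of "real m"] by (simp add: mult.assoc)
  finally show ?thesis by (simp add: p_def)
qed

text \<open>The packing bound with \<open>R = (4 * m + 2) / c\<close>: pivot cuts of one class range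
  over an interval of length \<open>(4 * m + 2) * \<tau>\<close> and are normalised by
  \<open>c * \<tau>\<close>.\<close>

definition pack_bound :: real where
  "pack_bound = (2 * ((4 * m + 2) / c) + 2) ^ DIM('a)"

text \<open>At the points of one class every pivot cut takes values between
  \<open>- (4 * m * \<tau>)\<close> and \<open>2 * \<tau>\<close>, whereas a pivot's own cut
  separates it from all later points by at least \<open>c * \<tau>\<close>. The packing bound then
  applies. The start \<open>s\<close> is common, but the target \<open>K j\<close> may vary with the
  pivot.\<close>

lemma card_pivots_of_class:
  assumes "finite J" and "0 < \<tau>" and "0 < r"
    and K: "\<And>j. j \<in> J \<Longrightarrow> s < K j \<and> pivot (K j) s = j \<and> r \<le> rate (K j) s \<and> rate (K j) s \<le> 2 * r"
    and \<tau>: "\<And>j. j \<in> J \<Longrightarrow> \<tau> \<le> \<phi> j \<and> \<phi> j \<le> 2 * \<tau>"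
  shows "card J \<le> pack_bound"
proof -
  have J: "s \<le> j" "j < K j" if "j \<in> J" for j
    using K[OF that] pivot_bounds[of s "K j"] by auto
  have lower: "- (4 * m * \<tau>) \<le> a p \<bullet> x i + b p" if p: "p \<in> J" and i: "i \<in> J" for p i
  proof (cases "i < K p")
    case True
    then have "- (m * \<phi> i) \<le> a p \<bullet> x i + b p"
      using pivot_cut_lower_before[of s i "K p"] J(1)[OF i] K[OF p] by simp
    moreover have "m * \<phi> i \<le> m * (4 * \<tau>)" using \<tau>[OF i] \<open>0 < \<tau>\<close> by (intro mult_left_mono) auto
    ultimately show ?thesis by simp
  next
    case False
    then have pi: "K p \<le> i" "p < i" using J(2)[OF p] by auto
    then have "r * (- (a p \<bullet> x i + b p)) \<le> rate (K p) s * (- (a p \<bullet> x i + b p))"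
      using K[OF p] cut_later[of p i] by (intro mult_right_mono) auto
    also have "\<dots> \<le> m * (g (K p) - g i)"
      using pivot_cut_lower_after[of s "K p" i] K[OF p] pi by simp
    also have "\<dots> \<le> m * ((2 * r) * (2 * \<tau>))"
    proof (rule mult_left_mono)
      \<comment> \<open>Widening the interval to the one from \<open>p\<close> to \<open>K i\<close>
        brings it under the rate of \<open>K i\<close>, whose window from \<open>s\<close> contains
        \<open>p\<close>; the rate of \<open>K p\<close> says nothing about steps after
        \<open>K p\<close>.\<close>
      have "g (K p) - g i \<le> g p - g (K i)"
        using g_strict[OF J(2)[OF p]] g_strict[OF J(2)[OF i]] by simp
      also have "\<dots> \<le> rate (K i) s * \<phi> p"
        using drop_le_rate[of s p "K i"] J(1)[OF p] J(2)[OF i] pi by simp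
      also have "\<dots> \<le> (2 * r) * (2 * \<tau>)"
        using K[OF i] \<tau>[OF p] \<open>0 < r\<close> \<phi>_pos[of p] by (intro mult_mono) auto
      finally show "g (K p) - g i \<le> (2 * r) * (2 * \<tau>)" .
    qed simp
    finally have "r * (- (a p \<bullet> x i + b p)) \<le> r * (4 * m * \<tau>)"
      by (simp only: ac_simps)
    then show ?thesis using \<open>0 < r\<close> by simp
  qed
  have upper: "a p \<bullet> x i + b p \<le> 2 * \<tau>" if "i \<in> J" for p i
    using cut_upper[of p i] \<tau>[OF that] by linarith
  define R where "R = (4 * m + 2) / c"
  have "real (card J) \<le> (2 * R + 2) ^ DIM('a)"
  proof (rule card_le_of_separating_functionals[where a = "\<lambda>p. (1 / (c * \<tau>)) *\<^sub>R a p" and x = x])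
    show "finite J" by fact
    show "0 \<le> R" using c_pos by (simp add: R_def)
    show "\<bar>((1 / (c * \<tau>)) *\<^sub>R a p) \<bullet> (x i - x j)\<bar> \<le> R" if "p \<in> J" "i \<in> J" "j \<in> J" for p i j
    proof -
      have "\<bar>a p \<bullet> (x i - x j)\<bar> \<le> (4 * m + 2) * \<tau>"
        using lower[OF that(1,2)] lower[OF that(1,3)] upper[OF that(2), of p] upper[OF that(3), of p]
        by (simp add: inner_diff_right abs_le_iff algebra_simps)
      then show ?thesis using c_pos \<open>0 < \<tau>\<close> by (simp add: R_def abs_mult field_simps)
    qed
    show "\<exists>p\<in>J. 1 \<le> \<bar>((1 / (c * \<tau>)) *\<^sub>R a p) \<bullet> (x i - x j)\<bar>" if "i \<in> J" "j \<in> J" "i \<noteq> j" for i j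
    proof -
      have *: "1 \<le> \<bar>((1 / (c * \<tau>)) *\<^sub>R a i) \<bullet> (x i - x j)\<bar>" if "i \<in> J" "j \<in> J" "i < j" for i j
      proof -
        \<comment> \<open>The cut of the earlier of the two points separates them: it is violated at
          its own point and satisfied at the later one.\<close>
        have "c * \<tau> \<le> c * \<phi> i" using \<tau>[OF that(1)] c_pos by simp
        also have "\<dots> \<le> a i \<bullet> (x i - x j)"
          using cut_own[of i] cut_later[OF that(3)] by (simp add: inner_diff_right)
        finally show ?thesis using c_pos \<open>0 < \<tau>\<close> by (simp add: abs_mult field_simps)
      qed
      show ?thesis
      proof (cases "i < j")
        case True
        then show ?thesis using * that by blast
      next
        case False
        then have "j < i" using \<open>i \<noteq> j\<close> by simp
        from *[OF \<open>j \<in> J\<close> \<open>i \<in> J\<close> this] show ?thesis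
          using \<open>j \<in> J\<close> by (metis abs_minus_cancel inner_minus_right minus_diff_eq)
      qed
    qed
  qed
  then show ?thesis by (simp add: pack_bound_def R_def)
qed

section \<open>Restarting after pivots: counting the reachable indices\<close>

definition successors :: "nat \<Rightarrow> nat \<Rightarrow> nat set" where
  "successors n s = (\<lambda>k. Suc (pivot k s)) ` {s<..n}"

text \<open>Pivots are sorted by the binary orders of magnitude of their violation and of the rate.
  The number of classes is quadratic in the logarithm of \<open>v / u\<close>, and each class holds
  at most \<open>pack_bound\<close> pivots.\<close>

lemma card_successors:
  assumes "0 < u" and "u \<le> v"
    and \<phi>: "\<And>j. j < n \<Longrightarrow> u \<le> \<phi> j \<and> \<phi> j \<le> v"
    and rate: "\<And>k. s < k \<Longrightarrow> k \<le> n \<Longrightarrow> u \<le> rate k s \<and> rate k s \<le> v"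
  shows "card (successors n s) \<le> pack_bound * (log 2 (v / u) + 2)\<^sup>2"
proof -
  define N where "N = {\<lfloor>log 2 u\<rfloor>..\<lfloor>log 2 v\<rfloor>}"
  have "\<lfloor>log 2 u\<rfloor> \<le> \<lfloor>log 2 v\<rfloor>" using assms by (intro floor_mono) simp
  then have "real (card N) = \<lfloor>log 2 v\<rfloor> - \<lfloor>log 2 u\<rfloor> + 1"
    by (simp add: N_def)
  \<comment> \<open>One unit is lost by rounding down \<open>log 2 u\<close>, the other by counting
    both endpoints.\<close>
  also have "\<dots> \<le> log 2 (v / u) + 2"
    using assms(1,2) by (simp add: log_divide) linarith
  finally have cardN: "real (card N) \<le> log 2 (v / u) + 2" .
  have inN: "\<lfloor>log 2 t\<rfloor> \<in> N" if "u \<le> t" "t \<le> v" for t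
    unfolding N_def using that \<open>0 < u\<close> by (auto intro!: floor_mono)
  have dyadic: "2 powr e \<le> t \<and> t \<le> 2 * 2 powr e" if "0 < t" "e = \<lfloor>log 2 t\<rfloor>" for t e
  proof -
    have "2 powr e \<le> 2 powr (log 2 t)" "2 powr (log 2 t) \<le> 2 powr (e + 1)"
      unfolding that(2) by (intro powr_mono; linarith)+
    then show ?thesis using \<open>0 < t\<close> by (simp add: powr_add)
  qed
  define J where "J = (\<lambda>(d, e). {pivot k s | k. s < k \<and> k \<le> n \<and>
    \<lfloor>log 2 (\<phi> (pivot k s))\<rfloor> = d \<and> \<lfloor>log 2 (rate k s)\<rfloor> = e})"
  have J_bound: "real (card (J z)) \<le> pack_bound" for z
  proof -
    obtain d e where z: "z = (d, e)" by (cases z)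
    define Q where "Q j k \<longleftrightarrow> s < k \<and> k \<le> n \<and> pivot k s = j \<and>
      \<lfloor>log 2 (\<phi> j)\<rfloor> = d \<and> \<lfloor>log 2 (rate k s)\<rfloor> = e" for j k
    \<comment> \<open>Several targets may share a pivot; one target within the class is selected for
      each.\<close>
    define K where "K j = (SOME k. Q j k)" for j
    have K: "Q j (K j)" if "j \<in> J z" for j
    proof -
      have "\<exists>k. Q j k" using that by (auto simp: J_def z Q_def)
      then show ?thesis unfolding K_def by (rule someI_ex)
    qed
    show ?thesis
    proof (rule card_pivots_of_class[where K = K])
      have "J z \<subseteq> (\<lambda>k. pivot k s) ` {..n}" by (auto simp: J_def z)
      then show "finite (J z)" using finite_subset by blast
      show "s < K j \<and> pivot (K j) s = j \<and> 2 powr e \<le> rate (K j) s \<and> rate (K j) s \<le> 2 * 2 powr e"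
        if "j \<in> J z" for j
        using K[OF that] dyadic[of "rate (K j) s" e] rate_pos[of s "K j"] by (auto simp: Q_def)
      show "2 powr d \<le> \<phi> j \<and> \<phi> j \<le> 2 * 2 powr d" if "j \<in> J z" for j
        using K[OF that] dyadic[of "\<phi> j" d] \<phi>_pos[of j] by (auto simp: Q_def)
    qed auto
  qed
  have finJ: "finite (J z)" for z
    by (rule finite_subset[of _ "(\<lambda>k. pivot k s) ` {..n}"]) (auto simp: J_def split: prod.splits)
  have "successors n s \<subseteq> (\<Union>z\<in>N \<times> N. Suc ` J z)"
  proof
    fix y assume "y \<in> successors n s"
    then obtain k where k: "s < k" "k \<le> n" "y = Suc (pivot k s)" by (auto simp: successors_def)
    have "\<lfloor>log 2 (\<phi> (pivot k s))\<rfloor> \<in> N"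
      using \<phi>[of "pivot k s"] pivot_bounds[OF k(1)] k(2) by (intro inN) auto
    moreover have "\<lfloor>log 2 (rate k s)\<rfloor> \<in> N" using rate[OF k(1,2)] by (intro inN) auto
    ultimately show "y \<in> (\<Union>z\<in>N \<times> N. Suc ` J z)"
      using k by (auto simp: J_def intro!: bexI[of _ "(\<lfloor>log 2 (\<phi> (pivot k s))\<rfloor>, \<lfloor>log 2 (rate k s)\<rfloor>)"])
  qed
  then have "card (successors n s) \<le> card (\<Union>z\<in>N \<times> N. Suc ` J z)"
    by (intro card_mono) (auto simp: N_def finJ)
  also have "\<dots> \<le> (\<Sum>z\<in>N \<times> N. card (Suc ` J z))"
    by (intro card_UN_le) (simp add: N_def)
  finally have "real (card (successors n s)) \<le> (\<Sum>z\<in>N \<times> N. real (card (J z)))"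
    by (simp add: card_image flip: of_nat_sum)
  also have "\<dots> \<le> (\<Sum>z\<in>N \<times> N. pack_bound)" by (intro sum_mono J_bound)
  also have "\<dots> = pack_bound * (real (card N))\<^sup>2"
    by (simp add: card_cartesian_product power2_eq_square)
  also have "\<dots> \<le> pack_bound * (log 2 (v / u) + 2)\<^sup>2"
    using cardN c_pos by (intro mult_left_mono power_mono) (auto simp: pack_bound_def)
  finally show ?thesis .
qed

text \<open>Restart points are collected for all targets up to \<open>n\<close> at once, so that a
  single count covers every target. Earlier points are kept, hence \<open>t\<close> bounds the
  number of moves.\<close>

primrec reachable :: "nat \<Rightarrow> nat \<Rightarrow> nat set" where
  "reachable n 0 = {0}"
| "reachable n (Suc t) = reachable n t \<union> (\<Union>s\<in>reachable n t. successors n s)"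

lemma finite_reachable: "finite (reachable n t)"
  by (induction t) (auto simp: successors_def)

lemma reachable_mono: "t \<le> t' \<Longrightarrow> reachable n t \<subseteq> reachable n t'"
  by (induction t' rule: nat_induct_at_least[of t]) (auto simp: le_Suc_eq intro: lift_Suc_mono_le)

lemma card_reachable:
  fixes q :: real
  assumes "0 \<le> q" and "\<And>s. card (successors n s) \<le> q"
  shows "card (reachable n t) \<le> (1 + q) ^ t"
proof (induction t)
  case (Suc t)
  have "card (reachable n (Suc t)) \<le> card (reachable n t) + card (\<Union>s\<in>reachable n t. successors n s)"
    by (simp add: card_Un_le)
  also have "card (\<Union>s\<in>reachable n t. successors n s) \<le> (\<Sum>s\<in>reachable n t. card (successors n s))"
    by (intro card_UN_le finite_reachable)
  finally have "real (card (reachable n (Suc t)))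
      \<le> real (card (reachable n t)) + (\<Sum>s\<in>reachable n t. real (card (successors n s)))"
    by (simp flip: of_nat_sum of_nat_add)
  also have "(\<Sum>s\<in>reachable n t. real (card (successors n s))) \<le> (\<Sum>s\<in>reachable n t. q)"
    by (intro sum_mono assms)
  also have "real (card (reachable n t)) + (\<Sum>s\<in>reachable n t. q) = (1 + q) * card (reachable n t)"
    by (simp add: algebra_simps)
  also have "\<dots> \<le> (1 + q) * (1 + q) ^ t"
    using Suc \<open>0 \<le> q\<close> by (intro mult_left_mono) auto
  finally show ?case by simp
qed simp

text \<open>Restarting after the pivot removes at least the pivot from the tail of \<open>k\<close>;
  once the tail is empty, the current index must be \<open>k\<close> itself.\<close>

lemma reachable_of_card_tail:
  assumes "s \<in> reachable n t" and "s \<le> k" and "k \<le> n" and "card (tail k s) \<le> d"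
  shows "k \<in> reachable n (t + d)"
  using assms
proof (induction d arbitrary: s t)
  case 0
  then have "tail k s = {}" using finite_tail by simp
  then have "s = k" using pivot_in_tail[of s k] \<open>s \<le> k\<close> by (cases "s < k") auto
  then show ?case using 0 by simp
next
  case (Suc d)
  show ?case
  proof (cases "s = k")
    case True
    then show ?thesis using Suc.prems(1) reachable_mono[of t "t + Suc d" n] by auto
  next
    case False
    then have "s < k" using Suc.prems by simp
    define p where "p = pivot k s"
    note p = pivot_bounds[OF \<open>s < k\<close>, folded p_def] pivot_in_tail[OF \<open>s < k\<close>, folded p_def]
    have "Suc p \<in> reachable n (Suc t)"
      using Suc.prems \<open>s < k\<close> by (force simp: successors_def p_def)
    moreover have "card (tail k (Suc p)) \<le> d"
    proof -
      have "tail k (Suc p) \<subseteq> tail k s - {p}" using p(1) by (auto simp: tail_def)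
      then have "card (tail k (Suc p)) \<le> card (tail k s - {p})"
        using finite_tail by (intro card_mono) auto
      then show ?thesis using p(4) finite_tail Suc.prems(4) by simp
    qed
    ultimately have "k \<in> reachable n (Suc t + d)"
      using Suc.IH[of "Suc p" "Suc t"] p(2) Suc.prems(3) by simp
    then show ?thesis by simp
  qed
qed

text \<open>Each index up to \<open>n\<close> is reached from 0 in \<open>m\<close> moves, since the
  tail of any target has at most \<open>m\<close> elements. So \<open>n\<close> is bounded by the
  size of a tree of depth \<open>m\<close> with the branching of
  \<open>card_successors\<close>.\<close>

lemma length_bound:
  assumes "0 < u" and "u \<le> v"
    and \<phi>: "\<And>j. j < n \<Longrightarrow> u \<le> \<phi> j \<and> \<phi> j \<le> v"
    and rate: "\<And>s k. s < k \<Longrightarrow> k \<le> n \<Longrightarrow> u \<le> rate k s \<and> rate k s \<le> v"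
  shows "real n \<le> (1 + pack_bound * (log 2 (v / u) + 2)\<^sup>2) ^ m"
proof -
  have "k \<in> reachable n m" if "k \<le> n" for k
    using reachable_of_card_tail[of 0 n 0 k m] that card_tail by simp
  then have "{..n} \<subseteq> reachable n m" by auto
  then have "card {..n} \<le> card (reachable n m)"
    by (intro card_mono finite_reachable)
  then have "real n \<le> real (card (reachable n m))" by simp
  also have "\<dots> \<le> (1 + pack_bound * (log 2 (v / u) + 2)\<^sup>2) ^ m"
    using c_pos by (intro card_reachable card_successors assms) (auto simp: pack_bound_def)
  finally show ?thesis .
qed

end

text \<open>A power of a logarithm grows more slowly than any positive power. The target
  \<open>1 / sqrt x\<close> is chosen because a step count of this order, with \<open>x\<close> the
  gap, means a gap of order \<open>1 / n\<^sup>2\<close>.\<close>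

lemma log_power_le_inverse_sqrt:
  fixes P M :: real
  assumes "0 \<le> P" and "0 < M" and "1 \<le> m"
  obtains C where "0 \<le> C"
    "\<And>x. 0 < x \<Longrightarrow> x\<^sup>2 \<le> M \<Longrightarrow> (1 + P * (log 2 (M / x\<^sup>2) + 2)\<^sup>2) ^ m \<le> C / sqrt x"
proof -
  \<comment> \<open>With this exponent the power \<open>2 * m\<close> of \<open>z powr s\<close> is
    \<open>z powr (1/4)\<close>, and \<open>z\<close> is a multiple of
    \<open>1 / x\<^sup>2\<close>.\<close>
  define s where "s = 1 / (8 * real m)"
  define K where "K = 1 / (s * ln 2)"
  have s: "s > 0" using \<open>1 \<le> m\<close> by (simp add: s_def)
  have K: "K > 0" using s by (simp add: K_def)
  define C where "C = ((1 + P) * K\<^sup>2) ^ m * (4 * M) powr (1/4)"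
  show ?thesis
  proof (rule that[of C])
    show "0 \<le> C" using assms by (simp add: C_def)
    fix x :: real assume x: "0 < x" "x\<^sup>2 \<le> M"
    define y where "y = M / x\<^sup>2"
    \<comment> \<open>The factor 4 absorbs the summand 2: \<open>q\<close> is the binary logarithm
      of \<open>z\<close>.\<close>
    define z where "z = 4 * y"
    define q where "q = log 2 y + 2"
    have "1 \<le> y" using x by (simp add: y_def pos_le_divide_eq)
    then have "z \<ge> 1" by (simp add: z_def)
    have "0 \<le> log 2 y" using \<open>1 \<le> y\<close> by (subst zero_le_log_cancel_iff) auto
    then have "q \<ge> 2" by (simp add: q_def)
    have four: "(4::real) = 2 powr 2" by simp
    have "ln z = ln (2 powr 2) + ln y"
      unfolding z_def four using \<open>1 \<le> y\<close> by (intro ln_mult_pos) auto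
    also have "ln (2 powr 2) = 2 * ln (2::real)" by (rule ln_powr) 
    finally have "q * ln 2 = ln z"
      unfolding q_def log_def by (simp only: distrib_right) simp
    then have "q = ln z / ln 2" by (simp add: eq_divide_eq)
    also have "\<dots> \<le> (z powr s / s) / ln 2"
      by (intro divide_right_mono ln_powr_bound \<open>z \<ge> 1\<close> s) simp
    also have "\<dots> = K * z powr s"
      by (simp add: K_def)
    finally have q: "q \<le> K * z powr s" .
    have "1 + P * q\<^sup>2 \<le> (1 + P) * q\<^sup>2"
      using power_mono[of 1 q 2] \<open>q \<ge> 2\<close> by (simp add: algebra_simps)
    also have "\<dots> \<le> (1 + P) * (K * z powr s)\<^sup>2"
      using q \<open>q \<ge> 2\<close> \<open>0 \<le> P\<close> by (intro mult_left_mono power_mono) auto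
    finally have "(1 + P * q\<^sup>2) ^ m \<le> ((1 + P) * (K * z powr s)\<^sup>2) ^ m"
      using \<open>0 \<le> P\<close> by (intro power_mono) auto
    also have "\<dots> = ((1 + P) * K\<^sup>2) ^ m * (z powr s) ^ (2 * m)"
      by (simp only: power_mult_distrib power_mult mult.assoc)
    also have "(z powr s) ^ (2 * m) = z powr (1/4)"
      using \<open>z \<ge> 1\<close> \<open>1 \<le> m\<close> by (simp add: powr_power s_def)
    also have "z powr (1/4) = (4 * M) powr (1/4) / sqrt x"
    proof -
      have "(x\<^sup>2) powr (1/4) = sqrt x"
      proof -
        have "x\<^sup>2 = x powr 2" using x by simp
        then show ?thesis using x by (simp only: powr_powr) (simp add: powr_half_sqrt)
      qed
      moreover have "z = (4 * M) / x\<^sup>2" by (simp add: z_def y_def)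
      ultimately show ?thesis using x \<open>0 < M\<close> by (simp add: powr_divide)
    qed
    finally show "(1 + P * (log 2 (M / x\<^sup>2) + 2)\<^sup>2) ^ m \<le> C / sqrt x"
      by (simp add: q_def C_def y_def)
  qed
qed

section \<open>Strongly concave quadratic programs\<close>

lemma objective_expand:
  "objective c \<mu> y = objective c \<mu> x + (c - \<mu> *\<^sub>R x) \<bullet> (y - x) - \<mu> / 2 * (norm (y - x))\<^sup>2"
proof -
  define h where "h = y - x"
  have y: "y = x + h" by (simp add: h_def)
  have "(norm (x + h))\<^sup>2 = (norm x)\<^sup>2 + 2 * (x \<bullet> h) + (norm h)\<^sup>2"
    by (simp add: power2_norm_eq_inner inner_add_left inner_add_right inner_commute[of h x])
  then show ?thesis
    unfolding y objective_def by (simp add: inner_add_right inner_diff_left distrib_left)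
qed

text \<open>Completing the square: maximising the objective over a set amounts to projecting
  \<open>(1 / \<mu>) *\<^sub>R c\<close> onto it.\<close>

lemma objective_eq_dist:
  assumes "\<mu> > 0"
  shows "objective c \<mu> y = (norm c)\<^sup>2 / (2 * \<mu>) - \<mu> / 2 * (dist ((1 / \<mu>) *\<^sub>R c) y)\<^sup>2"
proof -
  define z where "z = (1 / \<mu>) *\<^sub>R c"
  have c: "c = \<mu> *\<^sub>R z" using assms by (simp add: z_def)
  have "objective c \<mu> y = objective c \<mu> z - \<mu> / 2 * (norm (y - z))\<^sup>2"
    using objective_expand[of c \<mu> y z] by (simp add: c)
  moreover have "objective c \<mu> z = (norm c)\<^sup>2 / (2 * \<mu>)"
  proof -
    have "c \<bullet> z = \<mu> * (norm z)\<^sup>2" "(norm c)\<^sup>2 = \<mu>\<^sup>2 * (norm z)\<^sup>2"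
      by (simp_all add: c power2_norm_eq_inner power_mult_distrib)
    then show ?thesis
      using assms by (simp add: objective_def power2_eq_square)
  qed
  ultimately show ?thesis by (simp add: dist_norm norm_minus_commute z_def)
qed

lemma objective_le_iff_dist:
  assumes "\<mu> > 0"
  shows "objective c \<mu> y \<le> objective c \<mu> x \<longleftrightarrow> dist ((1 / \<mu>) *\<^sub>R c) x \<le> dist ((1 / \<mu>) *\<^sub>R c) y"
proof -
  have "s - \<mu> / 2 * p\<^sup>2 \<le> s - \<mu> / 2 * q\<^sup>2 \<longleftrightarrow> q \<le> p" if "0 \<le> p" "0 \<le> q" for s p q :: real
    using assms power_mono_iff[OF that(2,1), of 2] by simp
  then show ?thesis
    unfolding objective_eq_dist[OF assms] by simp
qed

lemma feasible_eq_halfspaces: "{\<theta>. feasible A \<theta>} = (\<Inter>(a, b)\<in>A. {\<theta>. a \<bullet> \<theta> \<le> - b})"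
  by (force simp: feasible_def)

lemma closed_feasible: "closed {\<theta>. feasible A \<theta>}"
  unfolding feasible_eq_halfspaces by (auto intro!: closed_INT closed_halfspace_le)

lemma convex_feasible: "convex {\<theta>. feasible A \<theta>}"
  unfolding feasible_eq_halfspaces by (auto intro!: convex_INT convex_halfspace_le)

lemma feasible_mono: "A \<subseteq> B \<Longrightarrow> feasible B \<theta> \<Longrightarrow> feasible A \<theta>"
  by (auto simp: feasible_def)

lemma feasibleD: "feasible A \<theta> \<Longrightarrow> (a, b) \<in> A \<Longrightarrow> a \<bullet> \<theta> + b \<le> 0"
  by (auto simp: feasible_def)

lemma mem_solutions_iff:
  "\<theta> \<in> solutions c \<mu> A \<longleftrightarrow> feasible A \<theta> \<and> (\<forall>y. feasible A y \<longrightarrow> objective c \<mu> y \<le> objective c \<mu> \<theta>)"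
  by (auto simp: solutions_def is_arg_max_linorder)

text \<open>A solution is the projection of \<open>(1 / \<mu>) *\<^sub>R c\<close> onto a closed
  convex set, so this is the obtuse angle property, rescaled by \<open>\<mu>\<close>.\<close>

lemma solution_variational:
  assumes "\<mu> > 0" and "\<theta> \<in> solutions c \<mu> A" and "feasible A y"
  shows "(c - \<mu> *\<^sub>R \<theta>) \<bullet> (y - \<theta>) \<le> 0"
proof -
  have "((1 / \<mu>) *\<^sub>R c - \<theta>) \<bullet> (y - \<theta>) \<le> 0"
    using assms
    by (intro any_closest_point_dot[OF convex_feasible closed_feasible, of \<theta> A])
      (auto simp: mem_solutions_iff objective_le_iff_dist)
  then have "\<mu> * (((1 / \<mu>) *\<^sub>R c - \<theta>) \<bullet> (y - \<theta>)) \<le> 0"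
    using \<open>\<mu> > 0\<close> by (simp add: mult_le_0_iff)
  also have "\<mu> * (((1 / \<mu>) *\<^sub>R c - \<theta>) \<bullet> (y - \<theta>)) = (c - \<mu> *\<^sub>R \<theta>) \<bullet> (y - \<theta>)"
    using \<open>\<mu> > 0\<close> by (simp add: inner_diff_left algebra_simps)
  finally show ?thesis .
qed

text \<open>The variational inequality removes the linear term of the exact expansion. Both
  uniqueness and the descent per cut rest on the remaining quadratic term.\<close>

lemma solution_quadratic_growth:
  assumes "\<mu> > 0" and "\<theta> \<in> solutions c \<mu> A" and "feasible A y"
  shows "objective c \<mu> y \<le> objective c \<mu> \<theta> - \<mu> / 2 * (norm (y - \<theta>))\<^sup>2"
  using solution_variational[OF assms] objective_expand[of c \<mu> y \<theta>] by simp

lemma solutions_singleton: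
  assumes "\<mu> > 0" and "\<theta> \<in> solutions c \<mu> A"
  shows "solutions c \<mu> A = {\<theta>}"
proof (intro antisym subsetI)
  fix y assume y: "y \<in> solutions c \<mu> A"
  then have "objective c \<mu> \<theta> \<le> objective c \<mu> y" "feasible A y"
    using assms(2) by (auto simp: mem_solutions_iff)
  then have "\<mu> / 2 * (norm (y - \<theta>))\<^sup>2 \<le> 0"
    using solution_quadratic_growth[OF assms, of y] by simp
  then show "y \<in> {\<theta>}" using \<open>\<mu> > 0\<close> by (simp add: mult_le_0_iff)
qed (use assms in auto)

text \<open>A closest feasible point to \<open>(1 / \<mu>) *\<^sub>R c\<close> exists, and
  uniqueness makes the definite description pick it.\<close>

lemma qp_solution_mem:
  assumes "\<mu> > 0" and "feasible A y"
  shows "qp_solution c \<mu> A \<in> solutions c \<mu> A"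
proof -
  obtain \<theta> where "\<theta> \<in> {\<theta>. feasible A \<theta>}"
    "\<And>y. y \<in> {\<theta>. feasible A \<theta>} \<Longrightarrow> dist ((1 / \<mu>) *\<^sub>R c) \<theta> \<le> dist ((1 / \<mu>) *\<^sub>R c) y"
    using distance_attains_inf[OF closed_feasible[of A]] assms(2) by blast
  then have "\<theta> \<in> solutions c \<mu> A"
    using \<open>\<mu> > 0\<close> by (auto simp: mem_solutions_iff objective_le_iff_dist)
  then show ?thesis
    unfolding qp_solution_def solutions_singleton[OF \<open>\<mu> > 0\<close> \<open>\<theta> \<in> solutions c \<mu> A\<close>] by simp
qed

section \<open>Optimality certificates with few multipliers\<close>

text \<open>Outside the cone, a separating direction would be feasible for the active cuts and increase the objective.\<close>

lemma qp_active_cone: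
  assumes "\<mu> > 0" and "finite A" and sol: "\<theta> \<in> solutions c \<mu> A"
  shows "c - \<mu> *\<^sub>R \<theta> \<in> convex_cone hull (fst ` {(a, b) \<in> A. a \<bullet> \<theta> + b = 0})"
proof (rule ccontr)
  define E where "E = fst ` {(a, b) \<in> A. a \<bullet> \<theta> + b = 0}"
  define v where "v = c - \<mu> *\<^sub>R \<theta>"
  have feas: "feasible A \<theta>" using sol by (simp add: mem_solutions_iff)
  have "finite E"
    unfolding E_def using \<open>finite A\<close> by (auto intro: finite_subset[of _ A])
  assume "\<not> ?thesis"
  then have "v \<notin> convex_cone hull E" by (simp add: v_def E_def)
  then obtain h \<beta> where h: "h \<bullet> v < \<beta>" "\<And>x. x \<in> convex_cone hull E \<Longrightarrow> \<beta> < h \<bullet> x"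
    using separating_hyperplane_closed_point[OF convex_convex_cone_hull closed_convex_cone_hull, OF \<open>finite E\<close>]
    by metis
  have "\<beta> < 0" using h(2)[OF convex_cone_hull_contains_0] by simp
  have nonneg: "0 \<le> h \<bullet> e" if "e \<in> E" for e
  proof (rule ccontr)
    assume neg: "\<not> 0 \<le> h \<bullet> e"
    \<comment> \<open>This multiple of \<open>e\<close> has inner product exactly
      \<open>\<beta>\<close> with \<open>h\<close>, which strict separation forbids.\<close>
    have "(\<beta> / (h \<bullet> e)) *\<^sub>R e \<in> convex_cone hull E"
      using that neg \<open>\<beta> < 0\<close> by (intro convex_cone_hull_mul hull_inc) (auto simp: divide_nonpos_nonpos)
    from h(2)[OF this] show False using neg by simp
  qed
  \<comment> \<open>A step along \<open>- h\<close> of this length keeps an inactive cut satisfied;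
    the summand 1 avoids division by zero. The element 1 in the minimum defining \<open>t\<close>
    covers the case without inactive cuts.\<close>
  define \<sigma> where "\<sigma> = (\<lambda>(a, b). - (a \<bullet> \<theta> + b) / (1 + \<bar>a \<bullet> h\<bar>))"
  define t where "t = Min (insert 1 (\<sigma> ` {(a, b) \<in> A. a \<bullet> \<theta> + b \<noteq> 0}))"
  have fin: "finite (insert 1 (\<sigma> ` {(a, b) \<in> A. a \<bullet> \<theta> + b \<noteq> 0}))"
    using \<open>finite A\<close> by (auto intro: finite_subset[of _ A])
  have "\<sigma> (a, b) > 0" if "(a, b) \<in> A" "a \<bullet> \<theta> + b \<noteq> 0" for a b
    using feasibleD[OF feas that(1)] that(2) unfolding \<sigma>_def by (auto intro!: divide_pos_pos)
  then have "t > 0" unfolding t_def using fin by (subst Min_gr_iff) auto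
  have "feasible A (\<theta> - t *\<^sub>R h)"
    unfolding feasible_def
  proof (clarify)
    fix a b assume ab: "(a, b) \<in> A"
    show "a \<bullet> (\<theta> - t *\<^sub>R h) + b \<le> 0"
    proof (cases "a \<bullet> \<theta> + b = 0")
      case True
      then have "a \<in> E" using ab by (force simp: E_def)
      then have "0 \<le> t * (a \<bullet> h)" using nonneg[of a] \<open>t > 0\<close> by (simp add: inner_commute)
      then show ?thesis using True by (simp add: inner_diff_right)
    next
      case False
      then have "t \<le> \<sigma> (a, b)" unfolding t_def using fin ab by (intro Min_le) auto
      then have "t * (1 + \<bar>a \<bullet> h\<bar>) \<le> - (a \<bullet> \<theta> + b)"
        unfolding \<sigma>_def by (simp add: pos_le_divide_eq)
      moreover have "t * (- (a \<bullet> h)) \<le> t * (1 + \<bar>a \<bullet> h\<bar>)"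
        using \<open>t > 0\<close> by (intro mult_left_mono) auto
      ultimately show ?thesis by (simp add: inner_diff_right)
    qed
  qed
  from solution_variational[OF \<open>\<mu> > 0\<close> sol this] have "0 \<le> t * (v \<bullet> h)"
    by (simp add: v_def)
  then show False
    using \<open>t > 0\<close> h(1) \<open>\<beta> < 0\<close> by (simp add: zero_le_mult_iff inner_commute)
qed

text \<open>A nonzero point of the cone is a nonnegative multiple of a point of the convex hull, to
  which the affine theorem of Caratheodory applies. All that matters later is that the bound depends
  on the dimension alone.\<close>

lemma convex_cone_hull_caratheodory:
  fixes v :: "'a::euclidean_space"
  assumes "v \<in> convex_cone hull E"
  obtains F u where "finite F" "F \<subseteq> E" "card F \<le> DIM('a) + 1" "\<And>x. 0 \<le> u x" "v = (\<Sum>x\<in>F. u x *\<^sub>R x)"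
proof (cases "v = 0")
  case True
  then show ?thesis using that[of "{}" "\<lambda>_. 0"] by simp
next
  case False
  then obtain w r where w: "w \<in> convex hull E" "0 \<le> r" "v = r *\<^sub>R w"
    using assms by (auto simp: convex_cone_hull_convex_hull)
  obtain F where F: "finite F" "F \<subseteq> E" "card F \<le> DIM('a) + 1" "w \<in> convex hull F"
    using w(1) unfolding caratheodory[of E] by blast
  obtain u where u: "\<forall>x\<in>F. 0 \<le> u x" "w = (\<Sum>x\<in>F. u x *\<^sub>R x)"
    using F(4) unfolding convex_hull_finite[OF F(1)] by blast
  show ?thesis
  proof (rule that[OF F(1-3), of "\<lambda>x. if x \<in> F then r * u x else 0"])
    show "v = (\<Sum>x\<in>F. (if x \<in> F then r * u x else 0) *\<^sub>R x)"
      unfolding w(3) u(2) scaleR_sum_right by (intro sum.cong) auto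
  qed (use u w in auto)
qed

text \<open>The gradient at the solution is a nonnegative combination of active normals; for an
  active cut, the inner product of its normal with \<open>y - \<theta>\<close> is the value of the
  cut at \<open>y\<close>. The concave quadratic term is dropped.\<close>

lemma qp_dual_certificate:
  fixes c :: "real^'k"
  assumes "\<mu> > 0" and "finite A" and sol: "\<theta> \<in> solutions c \<mu> A"
  obtains S l where "S \<subseteq> A" "card S \<le> CARD('k) + 1" "\<And>z. 0 \<le> l z"
    "\<And>y. objective c \<mu> y \<le> objective c \<mu> \<theta> + (\<Sum>z\<in>S. l z * (fst z \<bullet> y + snd z))"
proof -
  obtain F u where F: "finite F" "F \<subseteq> fst ` {(a, b) \<in> A. a \<bullet> \<theta> + b = 0}" "card F \<le> CARD('k) + 1"
    "\<And>x. 0 \<le> u x" "c - \<mu> *\<^sub>R \<theta> = (\<Sum>x\<in>F. u x *\<^sub>R x)"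
    using convex_cone_hull_caratheodory[OF qp_active_cone[OF assms]] by auto
  \<comment> \<open>Being active, a cut has its offset determined by its normal, so passing from
    normals to cuts is injective.\<close>
  define S where "S = (\<lambda>a. (a, - (a \<bullet> \<theta>))) ` F"
  have inj: "inj_on (\<lambda>a. (a, - (a \<bullet> \<theta>))) F" by (auto intro: inj_onI)
  show ?thesis
  proof (rule that[of S "\<lambda>z. u (fst z)"])
    show "S \<subseteq> A"
    proof
      fix z assume "z \<in> S"
      then obtain a where a: "a \<in> F" "z = (a, - (a \<bullet> \<theta>))" by (auto simp: S_def)
      then obtain b where "(a, b) \<in> A" "a \<bullet> \<theta> + b = 0" using F(2) by auto
      then show "z \<in> A" using a by (metis add.commute eq_neg_iff_add_eq_0)
    qed
    show "card S \<le> CARD('k) + 1" using F(3) inj by (simp add: S_def card_image)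
    fix y
    have "(c - \<mu> *\<^sub>R \<theta>) \<bullet> (y - \<theta>) = (\<Sum>z\<in>S. u (fst z) * (fst z \<bullet> y + snd z))"
      unfolding F(5) S_def sum.reindex[OF inj]
      by (simp add: inner_sum_left inner_diff_right right_diff_distrib sum_subtractf)
    then show "objective c \<mu> y \<le> objective c \<mu> \<theta> + (\<Sum>z\<in>S. u (fst z) * (fst z \<bullet> y + snd z))"
      using objective_expand[of c \<mu> y \<theta>] \<open>\<mu> > 0\<close> by simp
  qed (use F in auto)
qed

section \<open>Polynomial constraint functions\<close>

text \<open>Differentiability is asked in \<open>t\<close> and in \<open>x\<close> separately, which
  is what \<open>deriv\<close> and \<open>gradient\<close> in \<open>sip_Y1\<close> refer to; joint
  continuity serves the compactness argument.\<close>

definition separately_C1 :: "(real \<times> (real^'n) \<Rightarrow> real) \<Rightarrow> (real \<times> (real^'n) \<Rightarrow> real) \<Rightarrow> (real \<times> (real^'n) \<Rightarrow> real^'n) \<Rightarrow> bool"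
where
  "separately_C1 p pt px \<longleftrightarrow>
     continuous_on UNIV p \<and> continuous_on UNIV pt \<and> continuous_on UNIV px \<and>
     (\<forall>t x. ((\<lambda>s. p (s, x)) has_real_derivative pt (t, x)) (at t) \<and> (GDERIV (\<lambda>y. p (t, y)) x :> px (t, x)))"

lemma GDERIV_unique:
  assumes "GDERIV g x :> D" and "GDERIV g x :> D'"
  shows "D = D'"
proof -
  have "(\<lambda>h. h \<bullet> D) = (\<lambda>h. h \<bullet> D')"
    using assms unfolding gderiv_def by (rule has_derivative_unique)
  then have "\<forall>h. h \<bullet> D = h \<bullet> D'" by (simp add: fun_eq_iff)
  then show ?thesis by (rule vector_eq_ldot[THEN iffD1])
qed

lemma gradient_eq: "GDERIV g x :> D \<Longrightarrow> gradient g x = D"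
  unfolding gradient_def by (rule the_equality) (assumption, rule GDERIV_unique)

lemma separately_C1_const: "separately_C1 (\<lambda>z. k) (\<lambda>z. 0) (\<lambda>z. 0)"
  by (simp add: separately_C1_def GDERIV_const)

lemma separately_C1_fst: "separately_C1 fst (\<lambda>z. 1) (\<lambda>z. 0)"
  unfolding separately_C1_def
  by (simp add: GDERIV_const continuous_on_fst)

lemma separately_C1_nth: "separately_C1 (\<lambda>z::real \<times> (real^'n). snd z $ j) (\<lambda>z. 0) (\<lambda>z. axis j 1)"
proof -
  have "GDERIV (\<lambda>y::real^'n. y $ j) x :> axis j 1" for x
    unfolding gderiv_def inner_axis
    using bounded_linear.has_derivative[OF bounded_linear_vec_nth has_derivative_ident] by simp
  then show ?thesis
    unfolding separately_C1_def by (simp add: continuous_on_snd continuous_on_component)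
qed

lemma separately_C1_add:
  assumes "separately_C1 p pt px" and "separately_C1 q qt qx"
  shows "separately_C1 (\<lambda>z. p z + q z) (\<lambda>z. pt z + qt z) (\<lambda>z. px z + qx z)"
  using assms unfolding separately_C1_def
  by (intro conjI allI continuous_on_add DERIV_add GDERIV_add) blast+

lemma separately_C1_mult:
  assumes "separately_C1 p pt px" and "separately_C1 q qt qx"
  shows "separately_C1 (\<lambda>z. p z * q z) (\<lambda>z. pt z * q z + qt z * p z) (\<lambda>z. p z *\<^sub>R qx z + q z *\<^sub>R px z)"
  using assms unfolding separately_C1_def
  by (intro conjI allI continuous_on_add continuous_on_mult continuous_on_scaleR DERIV_mult GDERIV_mult) blast+

lemma separately_C1_sum:
  assumes "finite I" and "\<And>i. i \<in> I \<Longrightarrow> \<exists>pt px. separately_C1 (p i) pt px"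
  shows "\<exists>pt px. separately_C1 (\<lambda>z. \<Sum>i\<in>I. p i z) pt px"
  using assms
proof (induction I rule: finite_induct)
  case empty
  then show ?case using separately_C1_const[of 0] by auto
next
  case (insert i I)
  then obtain pt px qt qx where "separately_C1 (p i) pt px" "separately_C1 (\<lambda>z. \<Sum>i\<in>I. p i z) qt qx"
    by (metis insertCI)
  from separately_C1_add[OF this] insert.hyps show ?case by auto
qed

lemma separately_C1_prod:
  assumes "finite I" and "\<And>i. i \<in> I \<Longrightarrow> \<exists>pt px. separately_C1 (p i) pt px"
  shows "\<exists>pt px. separately_C1 (\<lambda>z. \<Prod>i\<in>I. p i z) pt px"
  using assms
proof (induction I rule: finite_induct)
  case empty
  then show ?case using separately_C1_const[of 1] by auto
next
  case (insert i I)
  then obtain pt px qt qx where "separately_C1 (p i) pt px" "separately_C1 (\<lambda>z. \<Prod>i\<in>I. p i z) qt qx"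
    by (metis insertCI)
  from separately_C1_mult[OF this] insert.hyps show ?case by auto
qed

lemma separately_C1_power:
  assumes "separately_C1 p pt px"
  shows "\<exists>qt qx. separately_C1 (\<lambda>z. p z ^ k) qt qx"
proof -
  have "\<exists>qt qx. separately_C1 (\<lambda>z. \<Prod>i<k. p z) qt qx"
    using assms by (intro separately_C1_prod) blast+
  then show ?thesis by simp
qed

lemma polys_upto_separately_C1:
  fixes p :: "real \<times> (real^'n) \<Rightarrow> real"
  assumes "p \<in> polys_upto d"
  shows "\<exists>pt px. separately_C1 p pt px"
proof -
  obtain C where C: "\<And>t x. p (t, x) =
      (\<Sum>(i, \<alpha>)\<in>exponents_upto d. C (i, \<alpha>) * (t ^ i * (\<Prod>j\<in>UNIV. x $ j ^ \<alpha> j)))"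
    using assms by (auto simp: polys_upto_def)
  have p: "p = (\<lambda>z. \<Sum>e\<in>exponents_upto d. C e * (fst z ^ fst e * (\<Prod>j\<in>UNIV. (snd z $ j) ^ snd e j)))"
  proof
    fix z
    show "p z = (\<Sum>e\<in>exponents_upto d. C e * (fst z ^ fst e * (\<Prod>j\<in>UNIV. (snd z $ j) ^ snd e j)))"
      using C[of "fst z" "snd z"] by (simp add: case_prod_unfold)
  qed
  show ?thesis
    unfolding p
  proof (rule separately_C1_sum[OF finite_exponents_upto])
    fix e :: "nat \<times> ('n \<Rightarrow> nat)"
    obtain qt qx where q: "separately_C1 (\<lambda>z::real \<times> (real^'n). fst z ^ fst e) qt qx"
      using separately_C1_power[OF separately_C1_fst] by blast
    have "\<exists>rt rx. separately_C1 (\<lambda>z::real \<times> (real^'n). \<Prod>j\<in>UNIV. (snd z $ j) ^ snd e j) rt rx"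
      by (intro separately_C1_prod separately_C1_power[OF separately_C1_nth]) simp
    then obtain rt rx where r: "separately_C1 (\<lambda>z::real \<times> (real^'n). \<Prod>j\<in>UNIV. (snd z $ j) ^ snd e j) rt rx"
      by blast
    show "\<exists>pt px. separately_C1 (\<lambda>z. C e * (fst z ^ fst e * (\<Prod>j\<in>UNIV. (snd z $ j) ^ snd e j))) pt px"
      by (intro exI) (rule separately_C1_mult[OF separately_C1_const separately_C1_mult[OF q r]])
  qed
qed

lemma affine_time_in_polys_upto:
  assumes "d \<ge> 1"
  shows "(\<lambda>(t, x). t - 1 - T) \<in> (polys_upto d :: (real \<times> (real^'n) \<Rightarrow> real) set)"
proof -
  define C where "C = (\<lambda>(i::nat, \<alpha>::'n::finite \<Rightarrow> nat).
    if \<alpha> = (\<lambda>_. 0) then if i = 0 then - 1 - T else if i = 1 then 1 else 0 else 0)"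
  have "t - 1 - T = (\<Sum>(i, \<alpha>)\<in>exponents_upto d. C (i, \<alpha>) * (t ^ i * (\<Prod>j\<in>UNIV. x $ j ^ \<alpha> j)))"
    (is "_ = sum ?F _") for t and x :: "real^'n"
  proof -
    have "sum ?F (exponents_upto d) = sum ?F {(0, \<lambda>_. 0), (1, \<lambda>_. 0)}"
      using assms by (intro sum.mono_neutral_right finite_exponents_upto)
        (auto simp: exponents_upto_def C_def split: if_splits)
    then show ?thesis by (simp add: C_def)
  qed
  then show ?thesis by (auto simp: polys_upto_def)
qed

text \<open>Spanning gives a coordinate vector, and linear independence makes it the only one, so
  the definite description is meaningful.\<close>

lemma coords_inner:
  assumes "is_poly_basis d \<Phi>" and "p \<in> polys_upto d"
  shows "coords \<Phi> p \<bullet> \<Phi> z = p z"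
proof -
  obtain \<theta> where \<theta>: "\<And>z. p z = \<theta> \<bullet> \<Phi> z"
    using assms unfolding is_poly_basis_def inner_vec_def by auto
  have "\<eta> = \<theta>" if "\<forall>z. p z = \<eta> \<bullet> \<Phi> z" for \<eta>
  proof -
    have "(\<eta> - \<theta>) \<bullet> \<Phi> z = 0" for z
      using that[rule_format, of z] \<theta>[of z] by (simp add: inner_diff_left)
    then have "\<forall>z. (\<Sum>j\<in>UNIV. (\<eta> - \<theta>) $ j * \<Phi> z $ j) = 0"
      by (simp add: inner_vec_def)
    then have "\<eta> - \<theta> = 0"
      using assms(1) unfolding is_poly_basis_def by blast
    then show ?thesis by simp
  qed
  then have "coords \<Phi> p = \<theta>"
    unfolding coords_def using \<theta> by (intro the_equality) auto
  then show ?thesis using \<theta> by simp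
qed

section \<open>The constraint set of the control problem: boundedness and a Slater point\<close>

locale poly_basis =
  fixes \<Phi> :: "real \<times> (real^'n) \<Rightarrow> real^'k" and d :: nat
    and \<Phi>t :: "'k \<Rightarrow> real \<times> (real^'n) \<Rightarrow> real" and \<Phi>x :: "'k \<Rightarrow> real \<times> (real^'n) \<Rightarrow> real^'n"
  assumes basis: "is_poly_basis d \<Phi>" and C1: "separately_C1 (\<lambda>z. \<Phi> z $ j) (\<Phi>t j) (\<Phi>x j)"
begin

text \<open>The vector of \<open>sip_Y1\<close> with the derivative operators replaced by the
  functions \<open>\<Phi>t\<close> and \<open>\<Phi>x\<close>, so that continuity becomes
  visible.\<close>

definition transport :: "(real \<times> (real^'n) \<times> (real^'m) \<Rightarrow> real^'n) \<Rightarrow> real \<times> (real^'n) \<times> (real^'m) \<Rightarrow> real^'k" where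
  "transport f w = (\<chi> j. - \<Phi>t j (fst w, fst (snd w)) - \<Phi>x j (fst w, fst (snd w)) \<bullet> f w)"

lemma deriv_component: "deriv (\<lambda>s. \<Phi> (s, x) $ j) t = \<Phi>t j (t, x)"
  using C1[of j] by (intro DERIV_imp_deriv) (simp add: separately_C1_def)

lemma gradient_component: "gradient (\<lambda>y. \<Phi> (t, y) $ j) x = \<Phi>x j (t, x)"
  using C1[of j] by (intro gradient_eq) (simp add: separately_C1_def)

lemma sip_Y1_eq: "sip_Y1 f T X U \<Phi> = (\<lambda>w. (transport f w, -1)) ` ({0..T} \<times> X \<times> U)"
  unfolding sip_Y1_def deriv_component gradient_component transport_def by force

lemma sip_Y2_eq: "sip_Y2 T Ktar \<Phi> = (\<lambda>z. (\<Phi> z, 0)) ` ({0..T} \<times> Ktar)"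
  unfolding sip_Y2_def by force

lemma continuous_basis: "continuous_on S \<Phi>"
proof -
  have "continuous_on UNIV (\<lambda>z. \<chi> j. \<Phi> z $ j)"
    using C1 by (intro continuous_on_vec_lambda) (simp add: separately_C1_def)
  then show ?thesis using continuous_on_subset[of UNIV \<Phi> S] by simp
qed

lemma continuous_transport:
  fixes f :: "real \<times> (real^'n) \<times> (real^'m) \<Rightarrow> real^'n"
  assumes "continuous_on UNIV f"
  shows "continuous_on S (transport f)"
proof -
  have proj: "continuous_on UNIV (\<lambda>w::real \<times> (real^'n) \<times> (real^'m). (fst w, fst (snd w)))"
    by (intro continuous_intros)
  have "continuous_on UNIV (\<Phi>t j)" "continuous_on UNIV (\<Phi>x j)" for j
    using C1[of j] by (auto simp: separately_C1_def)
  note comp = this[THEN continuous_on_compose2, OF proj subset_UNIV]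
  have "continuous_on UNIV (transport f)"
    unfolding transport_def using assms comp
    by (intro continuous_on_vec_lambda continuous_on_diff continuous_on_minus continuous_on_inner)
  then show ?thesis by (rule continuous_on_subset) simp
qed

lemma sip_Y_bounds:
  assumes "continuous_on UNIV f" and "compact X" and "compact U" and "compact Ktar"
  shows "\<exists>B. \<forall>(a, b)\<in>sip_Y f T X U Ktar \<Phi>. norm a \<le> B \<and> -1 \<le> b \<and> b \<le> 0"
proof -
  have "compact (transport f ` ({0..T} \<times> X \<times> U))"
    using assms by (intro compact_continuous_image continuous_transport compact_Times compact_Icc)
  then obtain B1 where B1: "\<forall>y\<in>transport f ` ({0..T} \<times> X \<times> U). norm y \<le> B1"
    using compact_imp_bounded bounded_iff by blast
  have "compact (\<Phi> ` ({0..T} \<times> Ktar))"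
    using assms by (intro compact_continuous_image continuous_basis compact_Times compact_Icc)
  then obtain B2 where B2: "\<forall>y\<in>\<Phi> ` ({0..T} \<times> Ktar). norm y \<le> B2"
    using compact_imp_bounded bounded_iff by blast
  have "norm a \<le> max B1 B2 \<and> -1 \<le> b \<and> b \<le> 0" if ab: "(a, b) \<in> sip_Y f T X U Ktar \<Phi>" for a b
  proof -
    consider "a \<in> transport f ` ({0..T} \<times> X \<times> U)" "b = -1" | "a \<in> \<Phi> ` ({0..T} \<times> Ktar)" "b = 0"
      using ab unfolding sip_Y_def sip_Y1_eq sip_Y2_eq by blast
    then show ?thesis
    proof cases
      case 1
      then have "norm a \<le> B1" using B1 by blast
      then show ?thesis using 1(2) by simp
    next
      case 2
      then have "norm a \<le> B2" using B2 by blast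
      then show ?thesis using 2(2) by simp
    qed
  qed
  then show ?thesis by blast
qed

text \<open>The polynomial \<open>t - 1 - T\<close> has time derivative 1 and spatial gradient 0, so
  the dynamics drop out. Both facts follow by differentiating its expansion in the basis and using
  uniqueness of derivatives.\<close>

lemma transport_affine_time:
  assumes "d \<ge> 1"
  shows "coords \<Phi> (\<lambda>(t, x). t - 1 - T) \<bullet> transport f (t, x, u) = - 1"
proof -
  define \<eta> where "\<eta> = coords \<Phi> (\<lambda>(t, x). t - 1 - T)"
  have \<eta>: "(\<Sum>j\<in>UNIV. \<eta> $ j * \<Phi> (s, y) $ j) = s - 1 - T" for s y
    using coords_inner[OF basis affine_time_in_polys_upto[OF assms], of T "(s, y)"]
    by (simp add: inner_vec_def \<eta>_def)
  have "((\<lambda>s. \<Sum>j\<in>UNIV. \<eta> $ j * \<Phi> (s, x) $ j) has_real_derivative (\<Sum>j\<in>UNIV. \<eta> $ j * \<Phi>t j (t, x))) (at t)"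
    using C1 unfolding separately_C1_def by (intro DERIV_sum DERIV_cmult) auto
  moreover have "((\<lambda>s. s - 1 - T) has_real_derivative 1) (at t)"
    by (auto intro!: derivative_eq_intros)
  ultimately have t: "(\<Sum>j\<in>UNIV. \<eta> $ j * \<Phi>t j (t, x)) = 1"
    unfolding \<eta> by (rule DERIV_unique)
  have "((\<lambda>y. \<Sum>j\<in>UNIV. \<eta> $ j * \<Phi> (t, y) $ j) has_derivative (\<lambda>h. \<Sum>j\<in>UNIV. \<eta> $ j * (h \<bullet> \<Phi>x j (t, x)))) (at x)"
    using C1 unfolding separately_C1_def gderiv_def
    by (intro has_derivative_sum has_derivative_mult_right) auto
  moreover have "((\<lambda>y::real^'n. t - 1 - T) has_derivative (\<lambda>h. 0)) (at x)"
    by (rule has_derivative_const)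
  ultimately have "(\<lambda>h. \<Sum>j\<in>UNIV. \<eta> $ j * (h \<bullet> \<Phi>x j (t, x))) = (\<lambda>h. 0)"
    unfolding \<eta> by (rule has_derivative_unique)
  then have "(\<Sum>j\<in>UNIV. \<eta> $ j * (f (t, x, u) \<bullet> \<Phi>x j (t, x))) = 0"
    by (rule fun_cong)
  then show ?thesis
    using t by (simp add: transport_def inner_vec_def[of \<eta>] \<eta>_def[symmetric] right_diff_distrib
      sum_subtractf sum_negf inner_commute)
qed

text \<open>On \<open>sip_Y1\<close> the value is exactly -1; on \<open>sip_Y2\<close> it is
  \<open>t - 1 - T\<close>, where \<open>t \<le> T\<close>.\<close>

lemma sip_Y_slater:
  assumes "d \<ge> 1" and "(a, b) \<in> sip_Y f T X U Ktar \<Phi>"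
  shows "a \<bullet> coords \<Phi> (\<lambda>(t, x). t - 1 - T) \<le> - 1"
  using assms(2) transport_affine_time[OF assms(1), of T f]
    coords_inner[OF basis affine_time_in_polys_upto[OF assms(1)], of T]
  unfolding sip_Y_def sip_Y1_eq sip_Y2_eq by (auto simp: inner_commute)

end

lemma poly_basis_exists:
  assumes "is_poly_basis d \<Phi>"
  shows "\<exists>\<Phi>t \<Phi>x. poly_basis \<Phi> d \<Phi>t \<Phi>x"
proof -
  have "\<forall>j. \<exists>pt px. separately_C1 (\<lambda>z. \<Phi> z $ j) pt px"
    using assms polys_upto_separately_C1 unfolding is_poly_basis_def by blast
  then show ?thesis using assms unfolding poly_basis_def by metis
qed

section \<open>Iterates of the cutting-plane algorithm\<close>

lemma ex_cp_stops_at: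
  assumes "\<exists>K. cp_test c \<mu> orc \<epsilon> Y0 K"
  shows "\<exists>K. cp_stops_at c \<mu> orc \<epsilon> Y0 K"
proof -
  have "cp_test c \<mu> orc \<epsilon> Y0 (LEAST K. cp_test c \<mu> orc \<epsilon> Y0 K)"
    using assms by (rule LeastI_ex)
  then show ?thesis
    unfolding cp_stops_at_def using not_less_Least by blast
qed

text \<open>The control problem enters only through bounded normals, offsets between -1 and 0, and
  the direction \<open>\<theta>h\<close> along which every cut falls at unit rate or faster.\<close>

locale cutting_plane =
  fixes Y Y0 :: "((real^'k) \<times> real) set" and c \<theta>h :: "real^'k" and \<mu> \<delta> B :: real
    and orc :: "real^'k \<Rightarrow> (real^'k) \<times> real"
  assumes \<mu>_pos: "\<mu> > 0" and \<delta>_nonneg: "0 \<le> \<delta>" and \<delta>_less_1: "\<delta> < 1"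
    and Y_nonempty: "Y \<noteq> {}"
    and Y_bounds: "(a, b) \<in> Y \<Longrightarrow> norm a \<le> B \<and> -1 \<le> b \<and> b \<le> 0"
    and slater: "(a, b) \<in> Y \<Longrightarrow> a \<bullet> \<theta>h \<le> -1"
    and finite_Y0: "finite Y0" and Y0_subset: "Y0 \<subseteq> Y"
    and orc_spec: "is_oracle Y \<delta> orc"
begin

abbreviation cuts :: "nat \<Rightarrow> ((real^'k) \<times> real) set" where
  "cuts \<equiv> cp_cuts c \<mu> orc Y0"

abbreviation \<theta> :: "nat \<Rightarrow> real^'k" where
  "\<theta> \<equiv> cp_iterate c \<mu> orc Y0"

abbreviation obj :: "real^'k \<Rightarrow> real" where
  "obj \<equiv> objective c \<mu>"

definition cut_value :: "nat \<Rightarrow> real^'k \<Rightarrow> real" where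
  "cut_value j \<eta> = fst (orc (\<theta> j)) \<bullet> \<eta> + snd (orc (\<theta> j))"

lemma B_pos: "0 < B"
proof -
  obtain a b where ab: "(a, b) \<in> Y" using Y_nonempty by auto
  then have "a \<noteq> 0" using slater by fastforce
  then show ?thesis using Y_bounds[OF ab] by (smt (verit) norm_le_zero_iff)
qed

lemma cut_le_max_violation:
  assumes "(a, b) \<in> Y"
  shows "a \<bullet> \<eta> + b \<le> max_violation Y \<eta>"
proof -
  have "bdd_above ((\<lambda>(a, b). a \<bullet> \<eta> + b) ` Y)"
  proof (rule bdd_aboveI2[where M = "B * norm \<eta>"])
    fix z assume "z \<in> Y"
    then show "(case z of (a, b) \<Rightarrow> a \<bullet> \<eta> + b) \<le> B * norm \<eta>"
      using Y_bounds[of "fst z" "snd z"] norm_cauchy_schwarz[of "fst z" \<eta>]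
        mult_right_mono[of "norm (fst z)" B "norm \<eta>"] by (auto simp: case_prod_unfold)
  qed
  from cSUP_upper[OF assms this] show ?thesis by (simp add: max_violation_def)
qed

lemma max_violation_le:
  assumes "\<And>a b. (a, b) \<in> Y \<Longrightarrow> a \<bullet> \<eta> + b \<le> M"
  shows "max_violation Y \<eta> \<le> M"
  unfolding max_violation_def using assms Y_nonempty by (intro cSUP_least) auto

lemma max_violation_le_norm: "max_violation Y \<eta> \<le> B * norm \<eta>"
proof (rule max_violation_le)
  fix a b assume ab: "(a, b) \<in> Y"
  have "a \<bullet> \<eta> \<le> norm a * norm \<eta>" by (rule norm_cauchy_schwarz)
  also have "\<dots> \<le> B * norm \<eta>" using Y_bounds[OF ab] by (intro mult_right_mono) auto
  finally show "a \<bullet> \<eta> + b \<le> B * norm \<eta>" using Y_bounds[OF ab] by simp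
qed

text \<open>Moving by \<open>e\<close> along \<open>\<theta>h\<close> lowers every cut by at least
  \<open>e\<close>, which repairs a violation of that size.\<close>

lemma feasible_shift:
  assumes "0 \<le> e" and "max_violation Y \<eta> \<le> e"
  shows "feasible Y (\<eta> + e *\<^sub>R \<theta>h)"
  unfolding feasible_def
proof clarify
  fix a b assume ab: "(a, b) \<in> Y"
  have "e * (a \<bullet> \<theta>h) \<le> e * (-1)" using slater[OF ab] assms(1) by (intro mult_left_mono)
  then show "a \<bullet> (\<eta> + e *\<^sub>R \<theta>h) + b \<le> 0"
    using cut_le_max_violation[OF ab, of \<eta>] assms(2) by (simp add: inner_add_right)
qed

lemma feasible_\<theta>h: "feasible Y \<theta>h"
  unfolding feasible_def using slater Y_bounds by fastforce

lemma orc_cut: "orc \<eta> \<in> Y"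
  using orc_spec by (simp add: is_oracle_def)

lemma orc_gap: "max_violation Y \<eta> - (fst (orc \<eta>) \<bullet> \<eta> + snd (orc \<eta>)) \<le> \<delta> * \<bar>max_violation Y \<eta>\<bar>"
  using orc_spec by (simp add: is_oracle_def case_prod_unfold)

lemma cp_test_iff: "cp_test c \<mu> orc \<epsilon> Y0 k \<longleftrightarrow> cut_value k (\<theta> k) \<le> \<epsilon>"
  by (simp add: cp_test_def cut_value_def case_prod_unfold Let_def)

text \<open>For a nonnegative maximal violation the oracle returns at least the fraction
  \<open>1 - \<delta>\<close> of it; a negative one satisfies the bound trivially.\<close>

lemma max_violation_le_cut_value:
  assumes "cut_value k (\<theta> k) \<le> \<epsilon>" and "0 \<le> \<epsilon>"
  shows "max_violation Y (\<theta> k) \<le> \<epsilon> / (1 - \<delta>)"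
proof (cases "0 \<le> max_violation Y (\<theta> k)")
  case True
  then have "(1 - \<delta>) * max_violation Y (\<theta> k) \<le> \<epsilon>"
    using orc_gap[of "\<theta> k"] assms(1) by (simp add: cut_value_def algebra_simps)
  then show ?thesis using \<delta>_less_1 by (simp add: pos_le_divide_eq mult.commute)
next
  case False
  moreover have "0 \<le> \<epsilon> / (1 - \<delta>)" using assms(2) \<delta>_less_1 by simp
  ultimately show ?thesis by linarith
qed

lemma cuts_eq: "cuts k = Y0 \<union> (\<lambda>j. orc (\<theta> j)) ` {..<k}"
  by (induction k) (auto simp: lessThan_Suc cp_iterate_def)

lemma finite_cuts: "finite (cuts k)"
  by (simp add: cuts_eq finite_Y0)

lemma cuts_subset: "cuts k \<subseteq> Y"
  using Y0_subset orc_cut by (auto simp: cuts_eq)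

lemma \<theta>_mem: "\<theta> k \<in> solutions c \<mu> (cuts k)"
  unfolding cp_iterate_def
  using feasible_mono[OF cuts_subset feasible_\<theta>h] by (intro qp_solution_mem \<mu>_pos)

lemma feasible_\<theta>: "k \<le> i \<Longrightarrow> feasible (cuts k) (\<theta> i)"
  using \<theta>_mem[of i] by (auto simp: mem_solutions_iff cuts_eq intro: feasible_mono[rotated])

lemma cut_value_later:
  assumes "j < i"
  shows "cut_value j (\<theta> i) \<le> 0"
proof -
  have "(fst (orc (\<theta> j)), snd (orc (\<theta> j))) \<in> cuts (Suc j)" by (simp add: cp_iterate_def)
  from feasibleD[OF feasible_\<theta> this, of i] show ?thesis
    using assms by (simp add: cut_value_def)
qed

text \<open>Every program of the run is a relaxation of the full one, so the iterates bound its
  value from above.\<close>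

lemma obj_le_\<theta>: "feasible Y \<eta> \<Longrightarrow> obj \<eta> \<le> obj (\<theta> k)"
  using \<theta>_mem[of k] feasible_mono[OF cuts_subset] by (auto simp: mem_solutions_iff)

lemma val_le_\<theta>: "val c \<mu> Y \<le> obj (\<theta> k)"
  unfolding val_def using feasible_\<theta>h obj_le_\<theta> by (intro cSUP_least) auto

lemma obj_le_val: "feasible Y \<eta> \<Longrightarrow> obj \<eta> \<le> val c \<mu> Y"
  unfolding val_def using obj_le_\<theta>[of _ 0] by (intro cSUP_upper) (auto intro!: bdd_aboveI2)

text \<open>The new cut is violated at \<open>\<theta> k\<close> and satisfied at the next iterate,
  so the two are at least the cut value divided by \<open>B\<close> apart; quadratic growth turns
  this distance into a decrease.\<close>

lemma descent:
  assumes "0 \<le> cut_value k (\<theta> k)"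
  shows "\<mu> / (2 * B\<^sup>2) * (cut_value k (\<theta> k))\<^sup>2 \<le> obj (\<theta> k) - obj (\<theta> (Suc k))"
proof -
  define h where "h = \<theta> k - \<theta> (Suc k)"
  have "cut_value k (\<theta> k) \<le> cut_value k (\<theta> k) - cut_value k (\<theta> (Suc k))"
    using cut_value_later[of k "Suc k"] by simp
  also have "\<dots> = fst (orc (\<theta> k)) \<bullet> h" by (simp add: cut_value_def h_def inner_diff_right)
  also have "\<dots> \<le> norm (fst (orc (\<theta> k))) * norm h" by (rule norm_cauchy_schwarz)
  also have "\<dots> \<le> B * norm h"
    using Y_bounds[of "fst (orc (\<theta> k))" "snd (orc (\<theta> k))"] orc_cut by (intro mult_right_mono) auto
  finally have "(cut_value k (\<theta> k))\<^sup>2 \<le> (B * norm h)\<^sup>2"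
    using assms by (intro power_mono)
  then have "\<mu> / (2 * B\<^sup>2) * (cut_value k (\<theta> k))\<^sup>2 \<le> \<mu> / (2 * B\<^sup>2) * (B * norm h)\<^sup>2"
    using \<mu>_pos by (intro mult_left_mono) auto
  also have "\<dots> = \<mu> / 2 * (norm (\<theta> (Suc k) - \<theta> k))\<^sup>2"
    using B_pos by (simp add: h_def power_mult_distrib norm_minus_commute)
  also have "\<dots> \<le> obj (\<theta> k) - obj (\<theta> (Suc k))"
    using solution_quadratic_growth[OF \<mu>_pos \<theta>_mem feasible_\<theta>[of k "Suc k"]] by simp
  finally show ?thesis .
qed

text \<open>Each step without success lowers the objective by a fixed amount, yet it never falls
  below the value of the full program.\<close>

lemma terminates:
  assumes "\<epsilon> > 0"
  shows "\<exists>K. cp_stops_at c \<mu> orc \<epsilon> Y0 K"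
proof -
  have "\<exists>K. cp_test c \<mu> orc \<epsilon> Y0 K"
  proof (rule ccontr)
    assume "\<not> ?thesis"
    then have big: "\<epsilon> < cut_value k (\<theta> k)" for k by (simp add: cp_test_iff not_le)
    define \<kappa> where "\<kappa> = \<mu> / (2 * B\<^sup>2) * \<epsilon>\<^sup>2"
    have "\<kappa> > 0" using \<mu>_pos B_pos assms by (simp add: \<kappa>_def)
    have "\<kappa> \<le> obj (\<theta> k) - obj (\<theta> (Suc k))" for k
    proof -
      have "\<kappa> \<le> \<mu> / (2 * B\<^sup>2) * (cut_value k (\<theta> k))\<^sup>2"
        unfolding \<kappa>_def using big[of k] assms \<mu>_pos by (intro mult_left_mono power_mono) auto
      then show ?thesis using descent[of k] big[of k] assms by simp
    qed
    then have step: "obj (\<theta> (Suc k)) \<le> obj (\<theta> k) - \<kappa>" for k by (simp add: algebra_simps)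
    have "obj (\<theta> k) \<le> obj (\<theta> 0) - k * \<kappa>" for k
    proof (induction k)
      case (Suc k)
      then show ?case using step[of k] by (simp add: distrib_right)
    qed simp
    then have "k * \<kappa> \<le> obj (\<theta> 0) - val c \<mu> Y" for k :: nat
      using val_le_\<theta>[of k] by (smt (verit))
    moreover obtain k :: nat where "obj (\<theta> 0) - val c \<mu> Y < k * \<kappa>"
      using reals_Archimedean3[OF \<open>\<kappa> > 0\<close>] by blast
    ultimately show False by (meson not_le)
  qed
  then show ?thesis by (rule ex_cp_stops_at)
qed

text \<open>The level set is a ball about \<open>(1 / \<mu>) *\<^sub>R c\<close>, hence bounded, so
  the supremum is a genuine bound.\<close>

lemma norm_le_level_radius:
  assumes "obj \<theta>h \<le> obj \<eta>"
  shows "norm \<eta> \<le> level_radius c \<mu> \<theta>h"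
proof -
  define z where "z = (1 / \<mu>) *\<^sub>R c"
  have "norm \<zeta> \<le> norm z + dist z \<theta>h" if "\<zeta> \<in> level_set c \<mu> \<theta>h" for \<zeta>
  proof -
    have "dist z \<zeta> \<le> dist z \<theta>h"
      using that unfolding z_def level_set_def by (simp add: objective_le_iff_dist[OF \<mu>_pos])
    moreover have "norm \<zeta> \<le> norm z + dist z \<zeta>"
      using norm_triangle_sub[of \<zeta> z] by (simp add: dist_norm norm_minus_commute)
    ultimately show ?thesis by simp
  qed
  then have "bdd_above (norm ` level_set c \<mu> \<theta>h)" by (intro bdd_aboveI2)
  then show ?thesis
    unfolding level_radius_def using assms by (intro cSUP_upper) (auto simp: level_set_def)
qed

text \<open>Both \<open>\<theta> k\<close> and \<open>\<theta>h\<close> lie in the level set, hence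
  have norm at most \<open>R\<close>. The cross term of the expansion costs at most
  \<open>e * \<mu> * R\<^sup>2\<close> and the quadratic term
  \<open>\<mu> / 2 * e\<^sup>2 * R\<^sup>2\<close>.\<close>

lemma obj_shift:
  assumes "0 \<le> e"
  shows "obj (\<theta> k) + e * (c \<bullet> \<theta>h) - e * (\<mu> * (level_radius c \<mu> \<theta>h)\<^sup>2 * (1 + e / 2)) \<le> obj (\<theta> k + e *\<^sub>R \<theta>h)"
proof -
  define R where "R = level_radius c \<mu> \<theta>h"
  have R: "norm (\<theta> k) \<le> R" "norm \<theta>h \<le> R"
    unfolding R_def using obj_le_\<theta>[OF feasible_\<theta>h] by (auto intro: norm_le_level_radius)
  have "\<theta> k \<bullet> \<theta>h \<le> R * R"
    using norm_cauchy_schwarz[of "\<theta> k" \<theta>h] mult_mono[OF R] R norm_ge_zero[of "\<theta> k"] by (smt (verit) norm_ge_zero)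
  then have "e * \<mu> * (\<theta> k \<bullet> \<theta>h) \<le> e * \<mu> * (R * R)"
    using assms \<mu>_pos by (intro mult_left_mono) auto
  moreover have "\<mu> / 2 * e\<^sup>2 * (norm \<theta>h)\<^sup>2 \<le> \<mu> / 2 * e\<^sup>2 * R\<^sup>2"
    using R \<mu>_pos by (intro mult_left_mono power_mono) auto
  moreover have "obj (\<theta> k + e *\<^sub>R \<theta>h) = obj (\<theta> k) + e * (c \<bullet> \<theta>h) - e * \<mu> * (\<theta> k \<bullet> \<theta>h) - \<mu> / 2 * e\<^sup>2 * (norm \<theta>h)\<^sup>2"
    using objective_expand[of c \<mu> "\<theta> k + e *\<^sub>R \<theta>h" "\<theta> k"] assms
    by (simp add: inner_diff_left power_mult_distrib right_diff_distrib)
  ultimately show ?thesis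
    unfolding R_def[symmetric] by (simp add: algebra_simps power2_eq_square)
qed

text \<open>The stopping test bounds the violation by \<open>e\<close>, so the shift by
  \<open>e\<close> along \<open>\<theta>h\<close> restores feasibility. The loss is that of
  \<open>obj_shift\<close>, counted from an iterate whose objective is at least the value.\<close>

lemma stop_quality:
  assumes "cut_value K (\<theta> K) \<le> \<epsilon>" and "0 \<le> \<epsilon>" and "c \<bullet> \<theta>h = - (1 + T)"
  defines "e \<equiv> \<epsilon> / (1 - \<delta>)"
  shows "feasible Y (\<theta> K + e *\<^sub>R \<theta>h)"
    and "e_optimal c \<mu> Y (opt_bound c \<mu> \<theta>h T e) (\<theta> K + e *\<^sub>R \<theta>h)"
proof -
  have e: "0 \<le> e" using assms(2) \<delta>_less_1 by (simp add: e_def)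
  show feas: "feasible Y (\<theta> K + e *\<^sub>R \<theta>h)"
    using max_violation_le_cut_value[OF assms(1,2)] e by (intro feasible_shift) (auto simp: e_def)
  have "val c \<mu> Y \<le> obj (\<theta> K)" by (rule val_le_\<theta>)
  then have "val c \<mu> Y - opt_bound c \<mu> \<theta>h T e \<le> obj (\<theta> K + e *\<^sub>R \<theta>h)"
    using obj_shift[OF e, of K] assms(3) by (simp add: opt_bound_def algebra_simps)
  then show "e_optimal c \<mu> Y (opt_bound c \<mu> \<theta>h T e) (\<theta> K + e *\<^sub>R \<theta>h)"
    using feas by (simp add: e_optimal_def)
qed

lemma stop_exact:
  assumes "cut_value K (\<theta> K) \<le> 0"
  shows "solutions c \<mu> Y = {\<theta> K}"
proof -
  have "feasible Y (\<theta> K)"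
    using feasible_shift[of 0 "\<theta> K"] max_violation_le_cut_value[OF assms] by simp
  then have "\<theta> K \<in> solutions c \<mu> Y"
    using obj_le_\<theta> by (auto simp: mem_solutions_iff)
  then show ?thesis by (rule solutions_singleton[OF \<mu>_pos])
qed

end

section \<open>Convergence rates along an infinite run\<close>

locale infinite_run = cutting_plane +
  assumes violated: "0 < cut_value k (\<theta> k)"
begin

abbreviation gap :: "nat \<Rightarrow> real" where
  "gap k \<equiv> obj (\<theta> k) - val c \<mu> Y"

abbreviation viol :: "nat \<Rightarrow> real" where
  "viol k \<equiv> max_violation Y (\<theta> k)"

text \<open>The constant of \<open>descent\<close> when progress is measured by the maximal
  violation; \<open>(1 - \<delta>)\<^sup>2\<close> accounts for the inexact oracle.\<close>

definition \<kappa> :: real where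
  "\<kappa> = \<mu> * (1 - \<delta>)\<^sup>2 / (2 * B\<^sup>2)"

lemma \<kappa>_pos: "0 < \<kappa>"
  using \<mu>_pos B_pos \<delta>_less_1 by (simp add: \<kappa>_def)

lemma cut_value_le_viol: "cut_value j (\<theta> i) \<le> viol i"
  using cut_le_max_violation[of "fst (orc (\<theta> j))" "snd (orc (\<theta> j))" "\<theta> i"] orc_cut
  by (simp add: cut_value_def)

lemma viol_pos: "0 < viol k"
  using cut_value_le_viol[of k k] violated[of k] by simp

lemma viol_le_cut_value: "(1 - \<delta>) * viol k \<le> cut_value k (\<theta> k)"
  using orc_gap[of "\<theta> k"] viol_pos[of k] by (simp add: cut_value_def algebra_simps)

lemma descent_viol: "\<kappa> * (viol k)\<^sup>2 \<le> obj (\<theta> k) - obj (\<theta> (Suc k))"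
proof -
  have "\<kappa> * (viol k)\<^sup>2 = \<mu> / (2 * B\<^sup>2) * ((1 - \<delta>) * viol k)\<^sup>2"
    by (simp add: \<kappa>_def power_mult_distrib)
  also have "\<dots> \<le> \<mu> / (2 * B\<^sup>2) * (cut_value k (\<theta> k))\<^sup>2"
    using viol_le_cut_value[of k] viol_pos[of k] \<delta>_less_1 \<mu>_pos by (intro mult_left_mono power_mono) auto
  also have "\<dots> \<le> obj (\<theta> k) - obj (\<theta> (Suc k))"
    using descent violated by (simp add: less_imp_le)
  finally show ?thesis .
qed

lemma obj_strict: "i < k \<Longrightarrow> obj (\<theta> k) < obj (\<theta> i)"
proof -
  assume "i < k"
  have "- obj (\<theta> n) < - obj (\<theta> (Suc n))" for n
  proof -
    have "0 < \<kappa> * (viol n)\<^sup>2" using \<kappa>_pos viol_pos[of n] by simp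
    then show ?thesis using descent_viol[of n] by linarith
  qed
  from lift_Suc_mono_less[of "\<lambda>n. - obj (\<theta> n)", OF this \<open>i < k\<close>] show ?thesis by simp
qed

lemma gap_pos: "0 < gap k"
  using obj_strict[of k "Suc k"] val_le_\<theta>[of "Suc k"] by simp

lemma viol_le: "viol k \<le> B * level_radius c \<mu> \<theta>h"
  using max_violation_le_norm[of "\<theta> k"] B_pos
    norm_le_level_radius[OF obj_le_\<theta>[OF feasible_\<theta>h], of k]
  by (smt (verit) mult_left_mono)

text \<open>Shifting \<open>\<theta> k\<close> by its violation along \<open>\<theta>h\<close> gives
  a feasible point, so the gap is at most the loss of the shift. The violations are bounded along
  the run, hence this loss is linear in them.\<close>

lemma gap_le_viol: "\<exists>C>0. \<forall>k. gap k \<le> C * viol k"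
proof -
  define V where "V = B * level_radius c \<mu> \<theta>h"
  define C where "C = \<bar>c \<bullet> \<theta>h\<bar> + \<mu> * (level_radius c \<mu> \<theta>h)\<^sup>2 * (1 + V / 2) + 1"
  have "0 \<le> V" using viol_le[of 0] viol_pos[of 0] by (simp add: V_def)
  then have "0 < C" unfolding C_def using \<mu>_pos by (intro add_nonneg_pos) auto
  moreover have "gap k \<le> C * viol k" for k
  proof -
    have "feasible Y (\<theta> k + viol k *\<^sub>R \<theta>h)"
      using viol_pos[of k] by (intro feasible_shift) auto
    then have "obj (\<theta> k + viol k *\<^sub>R \<theta>h) \<le> val c \<mu> Y" by (rule obj_le_val)
    then have "gap k \<le> viol k * (- (c \<bullet> \<theta>h) + \<mu> * (level_radius c \<mu> \<theta>h)\<^sup>2 * (1 + viol k / 2))"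
      using obj_shift[of "viol k" k] viol_pos[of k] by (simp add: algebra_simps)
    also have "\<dots> \<le> viol k * C"
    proof (rule mult_left_mono)
      have "\<mu> * (level_radius c \<mu> \<theta>h)\<^sup>2 * (1 + viol k / 2) \<le> \<mu> * (level_radius c \<mu> \<theta>h)\<^sup>2 * (1 + V / 2)"
        using viol_le[of k] \<mu>_pos by (intro mult_left_mono) (auto simp: V_def)
      then show "- (c \<bullet> \<theta>h) + \<mu> * (level_radius c \<mu> \<theta>h)\<^sup>2 * (1 + viol k / 2) \<le> C"
        unfolding C_def by linarith
    qed (use viol_pos[of k] in simp)
    finally show ?thesis by (simp add: mult.commute)
  qed
  ultimately show ?thesis by blast
qed

text \<open>A new cut is violated where all earlier ones hold. Hence multipliers on cuts can be
  indexed by the steps that generated them.\<close>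

lemma inj_cut: "inj (\<lambda>j. orc (\<theta> j))"
proof (rule linorder_injI)
  fix i j :: nat assume "i < j"
  show "orc (\<theta> i) \<noteq> orc (\<theta> j)"
  proof
    assume "orc (\<theta> i) = orc (\<theta> j)"
    then have "cut_value j (\<theta> j) = cut_value i (\<theta> j)" unfolding cut_value_def by simp
    then show False using cut_value_later[OF \<open>i < j\<close>] violated[of j] by linarith
  qed
qed

text \<open>All iterates satisfy the initial cuts, so the multipliers on cuts of \<open>Y0\<close>
  that no step has generated contribute nonpositive terms and are discarded.\<close>

lemma dual_certificate:
  "\<exists>S l. S \<subseteq> {..<k} \<and> card S \<le> CARD('a) + 1 \<and> (\<forall>j. 0 \<le> l j) \<and>
    (\<forall>i. obj (\<theta> i) \<le> obj (\<theta> k) + (\<Sum>j\<in>S. l j * cut_value j (\<theta> i)))"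
proof -
  obtain Z w where Z: "Z \<subseteq> cuts k" "card Z \<le> CARD('a) + 1" "\<And>z. 0 \<le> w z"
    "\<And>y. obj y \<le> obj (\<theta> k) + (\<Sum>z\<in>Z. w z * (fst z \<bullet> y + snd z))"
    by (rule qp_dual_certificate[OF \<mu>_pos finite_cuts \<theta>_mem[of k]]) (rule that)
  have finZ: "finite Z" using Z(1) finite_cuts finite_subset by blast
  define S where "S = {j. j < k \<and> orc (\<theta> j) \<in> Z}"
  have inj: "inj_on (\<lambda>j. orc (\<theta> j)) S" using inj_cut inj_on_subset by blast
  have img: "(\<lambda>j. orc (\<theta> j)) ` S \<subseteq> Z" by (auto simp: S_def)
  have "obj (\<theta> i) \<le> obj (\<theta> k) + (\<Sum>j\<in>S. w (orc (\<theta> j)) * cut_value j (\<theta> i))" for i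
  proof -
    let ?F = "\<lambda>z. w z * (fst z \<bullet> \<theta> i + snd z)"
    have "(\<Sum>z\<in>Z. ?F z) = (\<Sum>z\<in>Z - (\<lambda>j. orc (\<theta> j)) ` S. ?F z) + (\<Sum>z\<in>(\<lambda>j. orc (\<theta> j)) ` S. ?F z)"
      using sum.subset_diff[OF img finZ] .
    also have "(\<Sum>z\<in>Z - (\<lambda>j. orc (\<theta> j)) ` S. ?F z) \<le> 0"
    proof (intro sum_nonpos mult_nonneg_nonpos Z(3))
      fix z assume "z \<in> Z - (\<lambda>j. orc (\<theta> j)) ` S"
      then have "z \<in> Y0" using Z(1) unfolding cuts_eq S_def by blast
      then show "fst z \<bullet> \<theta> i + snd z \<le> 0"
        using feasibleD[OF feasible_\<theta>[of 0 i], of "fst z" "snd z"] by simp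
    qed
    also have "(\<Sum>z\<in>(\<lambda>j. orc (\<theta> j)) ` S. ?F z) = (\<Sum>j\<in>S. w (orc (\<theta> j)) * cut_value j (\<theta> i))"
      by (simp add: sum.reindex[OF inj] cut_value_def)
    finally show ?thesis using Z(4)[of "\<theta> i"] by simp
  qed
  moreover have "card S \<le> CARD('a) + 1"
    using card_mono[OF finZ img] Z(2) by (simp add: card_image[OF inj])
  moreover have "S \<subseteq> {..<k}" by (auto simp: S_def)
  moreover have "\<forall>j. 0 \<le> w (orc (\<theta> j))" using Z(3) by simp
  ultimately show ?thesis
    by (intro exI[of _ S] exI[of _ "\<lambda>j. w (orc (\<theta> j))"] conjI allI) simp_all
qed

text \<open>With \<open>x = gap n\<close>, all violations and rates up to step \<open>n\<close> lie
  between \<open>\<alpha> * x\<close> and \<open>W / x\<close>. So \<open>length_bound\<close> makes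
  \<open>n\<close> polylogarithmic in \<open>1 / x\<close>, hence at most a multiple of
  \<open>1 / sqrt x\<close>; squaring gives the claim.\<close>

lemma gap_rate: "\<exists>C\<ge>0. \<forall>n\<ge>1. gap n \<le> C / (real n)\<^sup>2"
proof -
  define m where "m = CARD('a) + 1"
  define P where "P k S l \<longleftrightarrow> S \<subseteq> {..<k} \<and> card S \<le> m \<and> (\<forall>j. 0 \<le> l j) \<and>
    (\<forall>i. obj (\<theta> i) \<le> obj (\<theta> k) + (\<Sum>j\<in>S. l j * cut_value j (\<theta> i)))" for k S and l :: "nat \<Rightarrow> real"
  have "\<forall>k. \<exists>S l. P k S l"
    unfolding P_def m_def by (intro allI dual_certificate)
  from choice[OF this] obtain S where S: "\<forall>k. \<exists>l. P k (S k) l" ..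
  from choice[OF S] obtain l where "\<forall>k. P k (S k) (l k)" ..
  then have Sl: "S k \<subseteq> {..<k}" "card (S k) \<le> m" "0 \<le> l k j"
    "obj (\<theta> i) \<le> obj (\<theta> k) + (\<Sum>j\<in>S k. l k j * cut_value j (\<theta> i))" for i j k
    by (simp_all add: P_def)
  interpret seq: cut_sequence \<theta> "\<lambda>j. fst (orc (\<theta> j))" "\<lambda>j. snd (orc (\<theta> j))" "\<lambda>k. obj (\<theta> k)" viol S l m "1 - \<delta>"
  proof
    show "1 \<le> m" "0 < 1 - \<delta>" using \<delta>_less_1 by (simp_all add: m_def)
    show "S k \<subseteq> {..<k}" "card (S k) \<le> m" "0 \<le> l k j" for k j by (rule Sl)+
    show "obj (\<theta> k) < obj (\<theta> i)" if "i < k" for i k using that by (rule obj_strict)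
    show "0 < viol i" for i by (rule viol_pos)
    show "fst (orc (\<theta> j)) \<bullet> \<theta> i + snd (orc (\<theta> j)) \<le> viol i" for i j
      using cut_value_le_viol by (simp only: cut_value_def)
    show "(1 - \<delta>) * viol j \<le> fst (orc (\<theta> j)) \<bullet> \<theta> j + snd (orc (\<theta> j))" for j
      using viol_le_cut_value by (simp only: cut_value_def)
    show "fst (orc (\<theta> j)) \<bullet> \<theta> i + snd (orc (\<theta> j)) \<le> 0" if "j < i" for i j
      using cut_value_later[OF that] by (simp only: cut_value_def)
    show "obj (\<theta> i) \<le> obj (\<theta> k) + (\<Sum>j\<in>S k. l k j * (fst (orc (\<theta> j)) \<bullet> \<theta> i + snd (orc (\<theta> j))))" for i k
      using Sl(4) by (simp only: cut_value_def)
  qed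
  obtain C1 where C1: "0 < C1" "\<And>k. gap k \<le> C1 * viol k" using gap_le_viol by blast
  define V where "V = B * level_radius c \<mu> \<theta>h"
  \<comment> \<open>\<open>W / x\<close> must dominate both the violation bound \<open>V\<close>,
    where \<open>x \<le> gap 0\<close> is used, and the largest possible rate
    \<open>gap 0 * C1 / x\<close>. The minimum in \<open>\<alpha>\<close> serves both lower bounds,
    \<open>x / C1\<close> for violations and \<open>\<kappa> * x / C1\<close> for rates.\<close>
  define W where "W = gap 0 * (V + C1)"
  define \<alpha> where "\<alpha> = min 1 \<kappa> / C1"
  define M where "M = W / \<alpha>"
  have V: "0 < V" using viol_pos[of 0] viol_le[of 0] by (simp add: V_def)
  have \<alpha>: "0 < \<alpha>" using \<kappa>_pos C1 by (simp add: \<alpha>_def)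
  have "0 < M" using gap_pos[of 0] V C1 \<alpha> by (simp add: M_def W_def)
  have gap_mono: "gap k \<le> gap i" if "i \<le> k" for i k
    using obj_strict[of i k] that by (cases "i = k") auto
  have bound: "real n \<le> (1 + seq.pack_bound * (log 2 (M / (gap n)\<^sup>2) + 2)\<^sup>2) ^ m \<and> (gap n)\<^sup>2 \<le> M" for n
  proof -
    define x where "x = gap n"
    have x: "0 < x" using gap_pos by (simp add: x_def)
    have low: "x / C1 \<le> viol j" if "j \<le> n" for j
    proof -
      have "x \<le> C1 * viol j" using gap_mono[OF that] C1(2)[of j] by (simp add: x_def)
      then show ?thesis using C1(1) by (simp add: pos_divide_le_eq mult.commute)
    qed
    have u_low: "\<alpha> * x \<le> x / C1" "\<alpha> * x \<le> \<kappa> * (x / C1)"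
    proof -
      have "0 \<le> x / C1" using x C1(1) by simp
      then show "\<alpha> * x \<le> x / C1" "\<alpha> * x \<le> \<kappa> * (x / C1)"
        using mult_right_mono[of "min 1 \<kappa>" 1 "x / C1"] mult_right_mono[of "min 1 \<kappa>" \<kappa> "x / C1"]
        by (simp_all add: \<alpha>_def)
    qed
    have v_up: "V \<le> W / x" "gap 0 / (x / C1) \<le> W / x"
    proof -
      have "V * x \<le> (V + C1) * gap 0"
        using gap_mono[of 0 n] V C1(1) x by (intro mult_mono) (auto simp: x_def)
      then show "V \<le> W / x"
        unfolding pos_le_divide_eq[OF x] W_def by (simp only: mult.commute)
      show "gap 0 / (x / C1) \<le> W / x"
      proof -
        have "gap 0 * C1 \<le> W" unfolding W_def using gap_pos[of 0] V by (intro mult_left_mono) auto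
        then have "gap 0 * C1 / x \<le> W / x" using x by (intro divide_right_mono) auto
        then show ?thesis by simp
      qed
    qed
    have \<phi>: "\<alpha> * x \<le> viol j \<and> viol j \<le> W / x" if "j \<le> n" for j
      using low[OF that] u_low(1) viol_le[of j] v_up(1) by (auto simp: V_def)
    have rate: "\<alpha> * x \<le> seq.rate k s \<and> seq.rate k s \<le> W / x" if "s < k" "k \<le> n" for s k
    proof
      \<comment> \<open>The step just before \<open>k\<close> always belongs to the window, so its
        own descent bounds the rate from below.\<close>
      obtain p where p: "k = Suc p" using \<open>s < k\<close> by (cases k) auto
      have "\<kappa> * (viol p)\<^sup>2 \<le> obj (\<theta> p) - obj (\<theta> k)" unfolding p by (rule descent_viol)
      also have "\<dots> \<le> seq.rate k s * viol p"
        using seq.drop_le_rate[of s p k] p \<open>s < k\<close> by simp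
      finally have "\<kappa> * viol p \<le> seq.rate k s"
        using viol_pos[of p] by (simp add: power2_eq_square)
      moreover have "\<kappa> * (x / C1) \<le> \<kappa> * viol p"
        using low[of p] p that \<kappa>_pos by (intro mult_left_mono) auto
      ultimately show "\<alpha> * x \<le> seq.rate k s" using u_low(2) by linarith
      obtain i where i: "s \<le> i" "i < k" "seq.rate k s = (obj (\<theta> i) - obj (\<theta> k)) / viol i"
        using seq.rate_attained[OF \<open>s < k\<close>] .
      have "(obj (\<theta> i) - obj (\<theta> k)) / viol i \<le> gap 0 / (x / C1)"
        using gap_mono[of 0 i] val_le_\<theta>[of k] gap_pos[of 0] low[of i] i(2) that x C1(1)
        by (intro frac_le) auto
      then show "seq.rate k s \<le> W / x" using i(3) v_up(2) by simp
    qed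
    have uv: "\<alpha> * x \<le> W / x" using \<phi>[of 0] by linarith
    have "real n \<le> (1 + seq.pack_bound * (log 2 ((W / x) / (\<alpha> * x)) + 2)\<^sup>2) ^ m"
      using \<alpha> x uv \<phi> rate by (intro seq.length_bound) auto
    moreover have "(W / x) / (\<alpha> * x) = M / x\<^sup>2" by (simp add: M_def power2_eq_square)
    moreover have "x\<^sup>2 \<le> M"
    proof -
      have "\<alpha> * x * x \<le> W" using uv unfolding pos_le_divide_eq[OF x] .
      then have "x\<^sup>2 * \<alpha> \<le> W" by (simp only: power2_eq_square ac_simps)
      then show ?thesis unfolding M_def pos_le_divide_eq[OF \<alpha>] .
    qed
    ultimately show ?thesis by (simp add: x_def)
  qed
  have pb: "0 \<le> seq.pack_bound" using \<delta>_less_1 by (simp add: seq.pack_bound_def)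
  obtain C where C: "0 \<le> C"
    "\<And>x. 0 < x \<Longrightarrow> x\<^sup>2 \<le> M \<Longrightarrow> (1 + seq.pack_bound * (log 2 (M / x\<^sup>2) + 2)\<^sup>2) ^ m \<le> C / sqrt x"
    by (rule log_power_le_inverse_sqrt[OF pb \<open>0 < M\<close> seq.m_ge_1]) (rule that)
  have "gap n \<le> C\<^sup>2 / (real n)\<^sup>2" if "1 \<le> n" for n
  proof -
    have "real n \<le> C / sqrt (gap n)" using bound[of n] C(2)[OF gap_pos, of n] by linarith
    moreover have "0 < sqrt (gap n)" using gap_pos[of n] by (rule real_sqrt_gt_zero)
    ultimately have "real n * sqrt (gap n) \<le> C" by (simp only: pos_le_divide_eq)
    then have "(real n * sqrt (gap n))\<^sup>2 \<le> C\<^sup>2"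
      using \<open>0 < sqrt (gap n)\<close> by (intro power_mono mult_nonneg_nonneg) auto
    moreover have "(sqrt (gap n))\<^sup>2 = gap n" using gap_pos[of n] by (intro real_sqrt_pow2) simp
    ultimately have "gap n * (real n)\<^sup>2 \<le> C\<^sup>2" by (simp only: power_mult_distrib mult.commute)
    moreover have "0 < (real n)\<^sup>2" using that by simp
    ultimately show ?thesis by (simp only: pos_le_divide_eq)
  qed
  then show ?thesis by (intro exI[of _ "C\<^sup>2"]) auto
qed

text \<open>The drop in one step is at most the current gap, so \<open>descent_viol\<close> bounds
  the squared violation by a multiple of \<open>1 / n\<^sup>2\<close>; the gap itself decays faster
  than required.\<close>

lemma rates:
  shows "(\<lambda>k. optimality_gap c \<mu> Y (\<theta> k)) \<in> O(\<lambda>k. 1 / real k)"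
    and "(\<lambda>k. feasibility_error Y (\<theta> k)) \<in> O(\<lambda>k. 1 / real k)"
proof -
  obtain C where C: "0 \<le> C" "\<And>n. 1 \<le> n \<Longrightarrow> gap n \<le> C / (real n)\<^sup>2" using gap_rate by blast
  show "(\<lambda>k. optimality_gap c \<mu> Y (\<theta> k)) \<in> O(\<lambda>k. 1 / real k)"
  proof (rule bigoI[where c = C], rule eventually_at_top_linorderI[of 1])
    fix n :: nat assume n: "1 \<le> n"
    have "real n * 1 \<le> real n * real n" using n by (intro mult_left_mono) auto
    then have "C / (real n)\<^sup>2 \<le> C / real n"
      using n by (intro divide_left_mono[OF _ C(1)]) (simp_all add: power2_eq_square)
    then show "norm (optimality_gap c \<mu> Y (\<theta> n)) \<le> C * norm (1 / real n)"
      using C(2)[OF n] gap_pos[of n] by (simp add: optimality_gap_def)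
  qed
  show "(\<lambda>k. feasibility_error Y (\<theta> k)) \<in> O(\<lambda>k. 1 / real k)"
  proof (rule bigoI[where c = "sqrt (C / \<kappa>)"], rule eventually_at_top_linorderI[of 1])
    fix n :: nat assume n: "1 \<le> n"
    have n2: "0 < (real n)\<^sup>2" using n by simp
    have "\<kappa> * (viol n)\<^sup>2 \<le> C / (real n)\<^sup>2"
      using descent_viol[of n] gap_pos[of "Suc n"] C(2)[OF n] by linarith
    then have "\<kappa> * (viol n)\<^sup>2 * (real n)\<^sup>2 \<le> C"
      unfolding pos_le_divide_eq[OF n2] .
    then have "(viol n * real n)\<^sup>2 * \<kappa> \<le> C"
      by (simp only: power_mult_distrib ac_simps)
    then have "(viol n * real n)\<^sup>2 \<le> C / \<kappa>"
      unfolding pos_le_divide_eq[OF \<kappa>_pos] .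
    then have "viol n * real n \<le> sqrt (C / \<kappa>)" by (rule real_le_rsqrt)
    then have "viol n \<le> sqrt (C / \<kappa>) / real n"
      using n by (subst pos_le_divide_eq) auto
    then show "norm (feasibility_error Y (\<theta> n)) \<le> sqrt (C / \<kappa>) * norm (1 / real n)"
      using viol_pos[of n] by (simp add: feasibility_error_def)
  qed
qed

end

lemma tendsto_0_of_bigo_inverse:
  fixes h :: "nat \<Rightarrow> real"
  assumes "h \<in> O(\<lambda>k. 1 / real k)"
  shows "h \<longlonglongrightarrow> 0"
proof -
  obtain K where K: "eventually (\<lambda>k. norm (h k) \<le> K * norm (1 / real k)) sequentially"
    by (rule landau_o.bigE[OF assms])
  have "(\<lambda>k. K * norm (1 / real k)) \<longlonglongrightarrow> K * norm (0::real)"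
    by (intro tendsto_mult tendsto_norm tendsto_const lim_1_over_n)
  then have "(\<lambda>k. K * norm (1 / real k)) \<longlonglongrightarrow> 0" by simp
  with K show ?thesis by (rule Lim_null_comparison)
qed

section \<open>The control problem as an instance of the abstract cutting-plane method\<close>

theorem theorem3p4:
  fixes f :: "real \<times> (real^'n) \<times> (real^'m) \<Rightarrow> real^'n"
    and T :: real
    and U :: "(real^'m) set"
    and X Ktar :: "(real^'n) set"
    and x0 :: "real^'n"
    and d :: nat
    and \<Phi> :: "real \<times> (real^'n) \<Rightarrow> real^'k"
    and \<mu> \<delta> \<epsilon> :: real
    and c \<theta>h :: "real^'k"
    and Y Y0 :: "((real^'k) \<times> real) set"
    and orc :: "real^'k \<Rightarrow> (real^'k) \<times> real"
    and \<theta> :: "nat \<Rightarrow> real^'k"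
  assumes "T > 0"
    and "\<exists>L. L-lipschitz_on UNIV f"
    and "compact U" and "U \<noteq> {}"
    and "compact X"
    and "compact Ktar" and "Ktar \<subseteq> X"
    and "x0 \<in> X"
    and "target_reachable f U X Ktar x0 T"
    and "d \<ge> 1"
    and "is_poly_basis d \<Phi>"
    and "\<mu> > 0"
    and "0 \<le> \<delta>" and "\<delta> < 1"
    and "\<epsilon> \<ge> 0"
    and c_def: "c = \<Phi> (0, x0)"
    and Y_def: "Y = sip_Y f T X U Ktar \<Phi>"
    and \<theta>h_def: "\<theta>h = coords \<Phi> (\<lambda>(t, x). t - 1 - T)"
    and "finite Y0" and "Y0 \<subseteq> Y"
    and "is_oracle Y \<delta> orc"
    and \<theta>_def: "\<theta> = cp_iterate c \<mu> orc Y0"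
  shows "(\<epsilon> > 0 \<longrightarrow>
            (\<exists>K. cp_stops_at c \<mu> orc \<epsilon> Y0 K \<and>
                 feasible Y (\<theta> K + (\<epsilon> / (1 - \<delta>)) *\<^sub>R \<theta>h) \<and>
                 e_optimal c \<mu> Y (opt_bound c \<mu> \<theta>h T (\<epsilon> / (1 - \<delta>)))
                   (\<theta> K + (\<epsilon> / (1 - \<delta>)) *\<^sub>R \<theta>h))) \<and>
         (\<epsilon> = 0 \<longrightarrow>
            (\<exists>K. cp_stops_at c \<mu> orc \<epsilon> Y0 K \<and> solutions c \<mu> Y = {\<theta> K}) \<or>
            (cp_runs_forever c \<mu> orc \<epsilon> Y0 \<and>
             (\<lambda>k. optimality_gap c \<mu> Y (\<theta> k)) \<longlonglongrightarrow> 0 \<and>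
             (\<lambda>k. feasibility_error Y (\<theta> k)) \<longlonglongrightarrow> 0 \<and>
             (\<lambda>k. optimality_gap c \<mu> Y (\<theta> k)) \<in> O(\<lambda>k. 1 / real k) \<and>
             (\<lambda>k. feasibility_error Y (\<theta> k)) \<in> O(\<lambda>k. 1 / real k)))"
proof -
  obtain \<Phi>t \<Phi>x where "poly_basis \<Phi> d \<Phi>t \<Phi>x"
    using poly_basis_exists[OF \<open>is_poly_basis d \<Phi>\<close>] by blast
  then interpret poly_basis \<Phi> d \<Phi>t \<Phi>x .
  have "continuous_on UNIV f"
    using assms(2) lipschitz_on_continuous_on by blast
  then obtain B where B: "\<forall>(a, b)\<in>Y. norm a \<le> B \<and> -1 \<le> b \<and> b \<le> 0"
    using sip_Y_bounds[of f X U Ktar T] assms(3,5,6) unfolding Y_def by blast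
  obtain u where "u \<in> U" using \<open>U \<noteq> {}\<close> by blast
  have "(0, x0, u) \<in> {0..T} \<times> X \<times> U"
    using \<open>T > 0\<close> \<open>x0 \<in> X\<close> \<open>u \<in> U\<close> by simp
  then have "Y \<noteq> {}"
    unfolding Y_def sip_Y_def sip_Y1_eq by blast
  interpret cutting_plane Y Y0 c \<theta>h \<mu> \<delta> B orc
  proof
    show "a \<bullet> \<theta>h \<le> -1" if "(a, b) \<in> Y" for a b
      using sip_Y_slater[OF \<open>d \<ge> 1\<close>] that unfolding Y_def \<theta>h_def by blast
    show "norm a \<le> B \<and> -1 \<le> b \<and> b \<le> 0" if "(a, b) \<in> Y" for a b
      using B that by blast
  qed (use assms \<open>Y \<noteq> {}\<close> in simp_all)
  have c\<theta>h: "c \<bullet> \<theta>h = - (1 + T)"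
    using coords_inner[OF \<open>is_poly_basis d \<Phi>\<close> affine_time_in_polys_upto[OF \<open>d \<ge> 1\<close>], of T "(0, x0)"]
    by (simp add: c_def \<theta>h_def inner_commute)
  show ?thesis
  proof (intro conjI impI)
    assume "\<epsilon> > 0"
    from terminates[OF this] obtain K where K: "cp_stops_at c \<mu> orc \<epsilon> Y0 K" ..
    then have "cut_value K (cp_iterate c \<mu> orc Y0 K) \<le> \<epsilon>"
      by (simp add: cp_stops_at_def cp_test_iff)
    from K stop_quality[OF this \<open>\<epsilon> \<ge> 0\<close> c\<theta>h]
    show "\<exists>K. cp_stops_at c \<mu> orc \<epsilon> Y0 K \<and> feasible Y (\<theta> K + (\<epsilon> / (1 - \<delta>)) *\<^sub>R \<theta>h) \<and>
        e_optimal c \<mu> Y (opt_bound c \<mu> \<theta>h T (\<epsilon> / (1 - \<delta>))) (\<theta> K + (\<epsilon> / (1 - \<delta>)) *\<^sub>R \<theta>h)"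
      unfolding \<theta>_def by blast
  next
    assume [simp]: "\<epsilon> = 0"
    show "(\<exists>K. cp_stops_at c \<mu> orc \<epsilon> Y0 K \<and> solutions c \<mu> Y = {\<theta> K}) \<or>
      (cp_runs_forever c \<mu> orc \<epsilon> Y0 \<and>
       (\<lambda>k. optimality_gap c \<mu> Y (\<theta> k)) \<longlonglongrightarrow> 0 \<and>
       (\<lambda>k. feasibility_error Y (\<theta> k)) \<longlonglongrightarrow> 0 \<and>
       (\<lambda>k. optimality_gap c \<mu> Y (\<theta> k)) \<in> O(\<lambda>k. 1 / real k) \<and>
       (\<lambda>k. feasibility_error Y (\<theta> k)) \<in> O(\<lambda>k. 1 / real k))"
    proof (cases "\<exists>K. cp_test c \<mu> orc \<epsilon> Y0 K")
      case True
      from ex_cp_stops_at[OF this] obtain K where K: "cp_stops_at c \<mu> orc \<epsilon> Y0 K" ..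
      then have "cut_value K (cp_iterate c \<mu> orc Y0 K) \<le> 0"
        by (simp add: cp_stops_at_def cp_test_iff)
      from K stop_exact[OF this] show ?thesis
        unfolding \<theta>_def by blast
    next
      case False
      then have "cp_runs_forever c \<mu> orc \<epsilon> Y0"
        by (simp add: cp_runs_forever_def)
      interpret infinite_run Y Y0 c \<theta>h \<mu> \<delta> B orc
      proof
        show "0 < cut_value k (cp_iterate c \<mu> orc Y0 k)" for k
          using False by (simp add: cp_test_iff not_le)
      qed
      show ?thesis
        using \<open>cp_runs_forever c \<mu> orc \<epsilon> Y0\<close> rates rates[THEN tendsto_0_of_bigo_inverse]
        unfolding \<theta>_def by blast
    qed
  qed
qed

end
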